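(* Let $F$ be a fixed finite graph with $v_F$ vertices and $e_F\ge2$ edges, and let $\alpha_F$ be the number of automorphisms of $F$. Let $p\in(0,1)$ and let $N_n$ be the number of copies of $F$ (not necessarily induced) in the Erdős--Rényi random graph $G(n,p)$. Let $$p_0:=\frac{e_F-1}{e_F-1+\exp\bigl(\frac{e_F}{e_F-1}\bigr)}.$$ (a) If $p>p_0$, then for any $r\in(p,1]$, $$\mathbb{P}\Bigl(N_n\ge\frac{v_F!}{\alpha_F}\binom n{v_F}r^{e_F}\Bigr)=\exp\Bigl(-\frac{n^2I(r,p)}{2}\bigl(1+O(n^{-1/2})\bigr)\Bigr).$$ (b) If $p\le p_0$, there exist $p',p''$ with $p<p'\le p''<1$ such that for all $r\in(p,p')\cup(p'',1]$, $$\mathbb{P}\Bigl(N_n\ge\frac{v_F!}{\alpha_F}\binom n{v_F}r^{e_F}\Bigr)=\exp\Bigl(-\frac{n^2I(r,p)}{2}\bigl(1+O(n^{-1/2})\bigr)\Bigr).$$ (c) Whenever $p>p_0$ and $r\in(p,1]$, or $p\le p_0$ and $r\in(p,p')\cup(p'',1]$ (with $p',p''$ as in (b)), there is also a constant $C(p,r)$ depending on $p$ and $r$ (and $F$) such that $$\mathbb{P}\Bigl(\Bigl|N_n-\frac{v_F!}{\alpha_F}\binom n{v_F}r^{e_F}\Bigr|\le C(p,r)\,n^{v_F-1/2}\Bigr)=\exp\Bigl(-\frac{n^2I(r,p)}{2}\bigl(1+O(n^{-1/2})\bigr)\Bigr).$$ Here $F$, $p$ and $r$ are fixed, $n\to\infty$,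 and the implied constants in $O(\cdot)$ may depend on $F$, $p$ and $r$.
   Context: $G(n,p)$ is the random graph on vertex set $\{1,\dots,n\}$ in which each edge is present independently with probability $p$. The number of (not necessarily induced) copies of $F$ in a graph on $[n]=\{1,\dots,n\}$ with adjacency indicators $x_{ij}=x_{ji}\in\{0,1\}$ is $\frac1{\alpha_F}\sum\prod_{(i,j)\in E(F)}x_{t_it_j}$, the sum being over all tuples $(t_1,\dots,t_{v_F})$ of distinct elements of $[n]$, where $V(F)=\{1,\dots,v_F\}$. For $r,s\in(0,1)$, $I(r,s):=r\log\frac rs+(1-r)\log\frac{1-r}{1-s}$, and $I(1,s):=\log(1/s)$ (extension by continuity). *)

theory Defs
  imports
    "HOL-Probability.Probability"
    "HOL-Library.Ramsey"
    "HOL-Library.Landau_Symbols"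
    "HOL-Combinatorics.Permutations"
begin

(* A simple graph on the vertex set V is given by its edge set E, a subset of [V]^2 (nsets V 2),
   the set of two-element subsets of V. *)

definition automorphisms :: "'a set \<Rightarrow> 'a set set \<Rightarrow> ('a \<Rightarrow> 'a) set" where
  "automorphisms V E = {\<sigma>. \<sigma> permutes V \<and> (\<lambda>e. \<sigma> ` e) ` E = E}"

(* Number of (not necessarily induced) copies of the graph (V, E) in the graph on {1..n} with edge
   set G. A tuple of distinct elements of {1..n} indexed by V is an injection t from V to {1..n},
   and the indicator of the edge of G joining t i and t j, for e = {i, j}, is
   of_bool (t ` e \<in> G). *)
definition num_copies :: "'a set \<Rightarrow> 'a set set \<Rightarrow> nat \<Rightarrow> nat set set \<Rightarrow> real" where
  "num_copies V E n G =
     (1 / real (card (automorphisms V E))) *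
     (\<Sum>t\<in>{t \<in> V \<rightarrow>\<^sub>E {1..n}. inj_on t V}. \<Prod>e\<in>E. of_bool (t ` e \<in> G))"

(* The Erdos-Renyi random graph, as a distribution on edge sets. *)
definition gnp :: "nat \<Rightarrow> real \<Rightarrow> nat set set pmf" where
  "gnp n p =
     map_pmf (\<lambda>x. {e \<in> nsets {1..n} 2. x e})
       (Pi_pmf (nsets {1..n} 2) False (\<lambda>_. bernoulli_pmf p))"

definition rel_entropy :: "real \<Rightarrow> real \<Rightarrow> real" where
  "rel_entropy r s =
     (if r = 1 then ln (1 / s) else r * ln (r / s) + (1 - r) * ln ((1 - r) / (1 - s)))"

definition p_crit :: "nat \<Rightarrow> real" where
  "p_crit e = (real e - 1) / (real e - 1 + exp (real e / (real e - 1)))"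

definition copy_level :: "'a set \<Rightarrow> 'a set set \<Rightarrow> nat \<Rightarrow> real \<Rightarrow> real" where
  "copy_level V E n r =
     fact (card V) / real (card (automorphisms V E)) * real (n choose card V) * r ^ card E"

(* P n = exp (- (n^2 c / 2) (1 + O(n^(-1/2)))) as n tends to infinity *)
definition decays_at_rate :: "(nat \<Rightarrow> real) \<Rightarrow> real \<Rightarrow> bool" where
  "decays_at_rate P c \<longleftrightarrow>
     (\<exists>\<epsilon>. \<epsilon> \<in> O(\<lambda>n. real n powr (- 1 / 2)) \<and>
       (\<forall>\<^sub>F n in sequentially. P n = exp (- (real n ^ 2 * c / 2) * (1 + \<epsilon> n))))"

end

(* Let A be the event that the graph has at least the prescribed number of copies, and let x be
   distributed as the edge indicators conditioned on A. Reveal the edges one at a time and let q_f be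
   the conditional probability of edge f given the edges revealed before it. By the chain rule for
   relative entropy, - ln P(A) is the expectation of the sum of I(q_f, p). The array x - q is a
   martingale difference sequence, so by Azuma's inequality and a union bound over 4^n pairs of vertex
   sets its cut norm is O(n^(3/2)); hence the homomorphism polynomials of x and q differ by
   O(n^(v - 1/2)), the source of the error term n^(-1/2). Finally AM-GM bounds the homomorphism
   polynomial of q by the average of q_f^e, and in the stated range of r the function I(y, p) lies
   above its tangent at r when viewed as a function of y^e, which gives the upper bound.
   The lower bound is a change of measure to G(n, r + K n^(-1/2)). At r = 1 the event
   is that the graph is complete. *)
theory Submission
  imports Defs "HOL-Probability.Hoeffding"
begin

text \<open>The obstacle is that the tail event has probability of order exp(-c n^2), so a
  concentration estimate for the product measure that fails with probability exp(-O(n)) says nothing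
  after conditioning. Martingale bounds survive, since they hold under every law once each indicator
  is centred at its own conditional mean; the price is that the means q_f are random, so every
  estimate on q must hold pointwise. The conditional law is never built: an induction over the edges
  carries entropy and exponential moments together. This closes because the cut norm is dominated by
  an affine combination of exponentials of linear forms. The scale n^(3/2) balances two counts: with
  edge weights of size n^(-1/2) the exponents are O(n), the order of the logarithm of the number of
  tests. After AM-GM one variable remains, and p_0 is the threshold above which I(y, p) is convex in
  y^e on (0, 1). Below it the tangent argument survives near p, where the tangent is nearly flat,
  and near 1, where its slope blows up. In the lower bound one event does two jobs, because the edge
  count in the likelihood ratio is itself a cut test.\<close>

section \<open>Relative entropy and conditioned product measures\<close>

text \<open>Hoeffding's lemma for a Bernoulli variable minus its mean, whose two values lie at
  distance one. Swapping the outcomes exchanges \<open>c\<close> with \<open>-c\<close> and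
  \<open>\<theta>\<close> with \<open>1 - \<theta>\<close>, which reduces to nonnegative
  \<open>c\<close>.\<close>

lemma two_point_exp_bound:
  fixes \<theta> c :: real
  assumes "0 \<le> \<theta>" "\<theta> \<le> 1"
  shows "\<theta> * exp (c * (1 - \<theta>)) + (1 - \<theta>) * exp (- (c * \<theta>)) \<le> exp (c\<^sup>2 / 8)"
proof -
  have nonneg: "\<theta> * exp (c * (1 - \<theta>)) + (1 - \<theta>) * exp (- (c * \<theta>)) \<le> exp (c\<^sup>2 / 8)"
    if c: "c \<ge> 0" and t: "0 \<le> \<theta>" "\<theta> \<le> 1" for c \<theta> :: real
  proof -
    have e: "exp c - 1 \<ge> 0" using c by simp
    have pos: "1 + \<theta> * (exp c - 1) > 0" using e t
      by (smt (verit) mult_nonneg_nonneg)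
    have "- c * \<theta> + ln (1 + \<theta> * (exp c - 1)) \<le> c\<^sup>2 / 8"
      by (rule Hoeffdings_lemma_aux[OF c t(1)])
    then have "exp (- c * \<theta> + ln (1 + \<theta> * (exp c - 1))) \<le> exp (c\<^sup>2 / 8)" by simp
    moreover have "exp (- c * \<theta> + ln (1 + \<theta> * (exp c - 1))) = exp (- c * \<theta>) * (1 + \<theta> * (exp c - 1))"
      using pos by (simp add: exp_diff exp_minus field_simps)
    moreover have "\<dots> = \<theta> * exp (c * (1 - \<theta>)) + (1 - \<theta>) * exp (- (c * \<theta>))"
      by (simp add: algebra_simps exp_diff exp_minus field_simps)
    ultimately show ?thesis by (simp only:)
  qed
  show ?thesis
  proof (cases "c \<ge> 0")
    case True then show ?thesis using nonneg assms by blast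
  next
    case False
    then show ?thesis using nonneg[of "-c" "1-\<theta>"] assms by (simp add: algebra_simps)
  qed
qed

lemma rel_entropy_0: "0 < p \<Longrightarrow> p < 1 \<Longrightarrow> rel_entropy 0 p = - ln (1 - p)"
  by (simp add: rel_entropy_def ln_div)

lemma rel_entropy_1: "0 < p \<Longrightarrow> rel_entropy 1 p = - ln p"
  by (simp add: rel_entropy_def ln_div)

lemma rel_entropy_interior:
  "0 < p \<Longrightarrow> p < 1 \<Longrightarrow> 0 < r \<Longrightarrow> r < 1 \<Longrightarrow>
   rel_entropy r p = r * (ln r - ln p) + (1 - r) * (ln (1 - r) - ln (1 - p))"
  by (simp add: rel_entropy_def ln_div)

text \<open>Conditioning on the first revealed coordinate: the two fibres of \<open>A\<close> are
  again events for a product measure, so an induction can recurse into them.\<close>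

lemma prob_bernoulli_product_insert:
  assumes "finite S" "a \<notin> S" "0 \<le> p" "p \<le> 1"
  shows "measure_pmf.prob (Pi_pmf (insert a S) False (\<lambda>_. bernoulli_pmf p)) A =
    p * measure_pmf.prob (Pi_pmf S False (\<lambda>_. bernoulli_pmf p)) {x. x(a := True) \<in> A} +
    (1 - p) * measure_pmf.prob (Pi_pmf S False (\<lambda>_. bernoulli_pmf p)) {x. x(a := False) \<in> A}"
proof -
  let ?P = "Pi_pmf S False (\<lambda>_. bernoulli_pmf p)"
  have "Pi_pmf (insert a S) False (\<lambda>_. bernoulli_pmf p)
     = bernoulli_pmf p \<bind> (\<lambda>y. map_pmf (\<lambda>x. x(a := y)) ?P)"
    using assms by (subst Pi_pmf_insert') (auto simp: map_pmf_def)
  then have "measure_pmf.prob (Pi_pmf (insert a S) False (\<lambda>_. bernoulli_pmf p)) A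
     = measure_pmf.expectation (bernoulli_pmf p)
         (\<lambda>y. measure_pmf.prob (map_pmf (\<lambda>x. x(a := y)) ?P) A)"
    using measurable_measure_pmf[of "\<lambda>y. map_pmf (\<lambda>x. x(a := y)) ?P"]
    by (simp only:) (simp only: measure_pmf_bind, subst measure_pmf.measure_bind[where N = "count_space UNIV"], auto)
  also have "\<dots> = p * measure_pmf.prob ?P {x. x(a := True) \<in> A} + (1 - p) * measure_pmf.prob ?P {x. x(a := False) \<in> A}"
    using assms by (simp add: vimage_def)
  finally show ?thesis .
qed

text \<open>
  The conclusion is what one gets from the pointwise hypothesis by integrating over the law of
  \<open>x\<close> conditioned on \<open>A\<close>, with \<open>q e\<close> the conditional probability of \<open>x e\<close> given the coordinates
  revealed before \<open>e\<close>: by the chain rule the entropies add up to \<open>- ln (P A)\<close>, and \<open>x - q\<close> is a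
  martingale difference sequence, to which Azuma's argument applies.
\<close>
lemma conditioned_product_entropy_bound:
  fixes W :: "'w set" and u :: "'w \<Rightarrow> real" and w :: "'w \<Rightarrow> 'e \<Rightarrow> real"
  assumes "finite S" and p: "0 < p" "p < 1" and fin: "finite W"
    and u: "\<And>k. k \<in> W \<Longrightarrow> u k \<ge> 0"
    and pos: "measure_pmf.prob (Pi_pmf S False (\<lambda>_. bernoulli_pmf p)) A > 0"
    and bound: "\<And>x q. x \<in> A \<Longrightarrow> (\<And>e. 0 \<le> q e \<and> q e \<le> 1) \<Longrightarrow>
       b \<le> (\<Sum>e\<in>S. rel_entropy (q e) p)
          + (\<Sum>k\<in>W. u k * exp (\<Sum>e\<in>S. w k e * (of_bool (x e) - q e)))"
  shows "b \<le> - ln (measure_pmf.prob (Pi_pmf S False (\<lambda>_. bernoulli_pmf p)) A)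
          + (\<Sum>k\<in>W. u k * exp (\<Sum>e\<in>S. (w k e)\<^sup>2 / 8))"
  using assms(1) u pos bound
proof (induction S arbitrary: A u b rule: finite_induct)
  case empty
  have "A \<noteq> {}" using empty(2) by (metis less_irrefl measure_empty)
  then obtain x where x: "x \<in> A" by blast
  have "measure_pmf.prob (Pi_pmf {} False (\<lambda>_. bernoulli_pmf p)) A = 1"
    using empty(2) by (auto simp: measure_return_pmf indicator_def split: if_splits)
  then show ?case using empty(3)[OF x, of "\<lambda>_. 0"] by simp
next
  case (insert a S)
  let ?P = "\<lambda>A. measure_pmf.prob (Pi_pmf S False (\<lambda>_. bernoulli_pmf p)) A"
  define A' where "A' = (\<lambda>y. {x. x(a := y) \<in> A})"
  define s where "s = ?P (A' True)"
  define t where "t = ?P (A' False)"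
  define PA where "PA = measure_pmf.prob (Pi_pmf (insert a S) False (\<lambda>_. bernoulli_pmf p)) A"
  have PA: "PA = p * s + (1 - p) * t"
    unfolding PA_def s_def t_def A'_def
    using prob_bernoulli_product_insert[of S a p A] insert.hyps p by simp
  have st: "s \<ge> 0" "t \<ge> 0" by (auto simp: s_def t_def)
  have PApos: "PA > 0" using insert.prems(2) by (simp add: PA_def)
  \<comment> \<open>By Bayes' rule this is the probability of \<open>x a\<close> conditioned on
    \<open>A\<close>, hence the value of \<open>q\<close> at the coordinate revealed first.\<close>
  define \<theta> where "\<theta> = p * s / PA"
  have th1: "1 - \<theta> = (1 - p) * t / PA"
    using PApos PA by (simp add: \<theta>_def field_simps)
  have th: "0 \<le> \<theta>" "\<theta> \<le> 1"
    using th1 st p PApos by (simp add: \<theta>_def, smt (verit) divide_nonneg_pos mult_nonneg_nonneg)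
  define v where "v = (\<lambda>k. exp (\<Sum>e\<in>S. (w k e)\<^sup>2 / 8))"
  define d where "d = (\<lambda>y::bool. of_bool y - \<theta>)"
  \<comment> \<open>Once \<open>x a = y\<close> is known, the factor
    \<open>exp (w k a * d y)\<close> is a constant and is absorbed into the coefficient
    \<open>u k\<close>. For this reason \<open>u\<close> is generalised in the induction, along with
    \<open>A\<close> and \<open>b\<close>.\<close>
  have step: "b - rel_entropy \<theta> p \<le> - ln (?P (A' y)) + (\<Sum>k\<in>W. (u k * exp (w k a * d y)) * v k)"
    if ypos: "?P (A' y) > 0" for y
    unfolding v_def
  proof (rule insert.IH)
    fix x q assume x: "x \<in> A' y" and q: "\<And>e::'e. 0 \<le> q e \<and> q e \<le> (1::real)"
    have ne: "e \<noteq> a" if "e \<in> S" for e using that insert.hyps by auto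
    have "b \<le> (\<Sum>e\<in>insert a S. rel_entropy ((q(a := \<theta>)) e) p)
          + (\<Sum>k\<in>W. u k * exp (\<Sum>e\<in>insert a S. w k e * (of_bool ((x(a := y)) e) - (q(a := \<theta>)) e)))"
      by (rule insert.prems(3)) (use x q th in \<open>simp_all only: A'_def mem_Collect_eq\<close>, simp)
    also have "(\<Sum>e\<in>insert a S. rel_entropy ((q(a := \<theta>)) e) p)
        = rel_entropy \<theta> p + (\<Sum>e\<in>S. rel_entropy (q e) p)"
      using insert.hyps ne by (simp add: sum.insert cong: sum.cong)
    also have "(\<Sum>k\<in>W. u k * exp (\<Sum>e\<in>insert a S. w k e * (of_bool ((x(a := y)) e) - (q(a := \<theta>)) e)))
        = (\<Sum>k\<in>W. u k * exp (w k a * d y + (\<Sum>e\<in>S. w k e * (of_bool (x e) - q e))))"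
      using insert.hyps ne by (simp add: sum.insert d_def cong: sum.cong)
    finally show "b - rel_entropy \<theta> p \<le> (\<Sum>e\<in>S. rel_entropy (q e) p)
          + (\<Sum>k\<in>W. u k * exp (w k a * d y) * exp (\<Sum>e\<in>S. w k e * (of_bool (x e) - q e)))"
      by (simp add: exp_add mult.assoc)
  qed (use ypos insert.prems(1) in auto)
  \<comment> \<open>The Azuma step: averaging the new factor over the conditional law of
    \<open>x a\<close> costs \<open>exp ((w k a)\<^sup>2 / 8)\<close>.\<close>
  have avg: "\<theta> * (\<Sum>k\<in>W. (u k * exp (w k a * d True)) * v k) + (1 - \<theta>) * (\<Sum>k\<in>W. (u k * exp (w k a * d False)) * v k)
     \<le> (\<Sum>k\<in>W. u k * exp (\<Sum>e\<in>insert a S. (w k e)\<^sup>2 / 8))"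
  proof -
    have "\<theta> * (\<Sum>k\<in>W. (u k * exp (w k a * d True)) * v k) + (1 - \<theta>) * (\<Sum>k\<in>W. (u k * exp (w k a * d False)) * v k)
      = (\<Sum>k\<in>W. u k * v k * (\<theta> * exp (w k a * (1 - \<theta>)) + (1 - \<theta>) * exp (- (w k a * \<theta>))))"
      by (simp add: sum_distrib_left d_def sum.distrib[symmetric] algebra_simps)
    also have "\<dots> \<le> (\<Sum>k\<in>W. u k * v k * exp ((w k a)\<^sup>2 / 8))"
      using insert.prems(1) th
      by (intro sum_mono mult_left_mono two_point_exp_bound) (auto simp: v_def)
    also have "\<dots> = (\<Sum>k\<in>W. u k * exp (\<Sum>e\<in>insert a S. (w k e)\<^sup>2 / 8))"
      using insert.hyps by (simp add: v_def exp_add algebra_simps)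
    finally show ?thesis .
  qed
  \<comment> \<open>The chain rule for relative entropy at one coordinate. If a fibre is null then
    \<open>\<theta>\<close> is 0 or 1, and the term with the logarithm of its probability carries
    coefficient zero.\<close>
  have lnPA: "- ln PA = \<theta> * (- ln s) + (1 - \<theta>) * (- ln t) + rel_entropy \<theta> p"
  proof -
    consider "s = 0" | "t = 0" | "s > 0" "t > 0" using st by linarith
    then show ?thesis
    proof cases
      case 1
      then have "t > 0" using PApos PA p by (auto simp: zero_less_mult_iff)
      then show ?thesis using 1 PA p by (simp add: \<theta>_def rel_entropy_0 ln_mult)
    next
      case 2
      then have "s > 0" using PApos PA p by (auto simp: zero_less_mult_iff)
      then show ?thesis using 2 PA p by (simp add: \<theta>_def rel_entropy_1 ln_mult)
    next
      case 3
      have "\<theta> > 0" "1 - \<theta> > 0" unfolding th1 using 3 p PApos by (simp_all add: \<theta>_def)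
      then have r: "rel_entropy \<theta> p = \<theta> * (ln \<theta> - ln p) + (1 - \<theta>) * (ln (1 - \<theta>) - ln (1 - p))"
        using p by (intro rel_entropy_interior) auto
      have l1: "ln \<theta> = ln p + ln s - ln PA" using 3 p PApos by (simp add: \<theta>_def ln_div ln_mult)
      have l2: "ln (1 - \<theta>) = ln (1 - p) + ln t - ln PA"
        unfolding th1 using 3 p PApos by (simp add: ln_div ln_mult)
      show ?thesis unfolding r l1 l2 by (simp add: algebra_simps)
    qed
  qed
  have T: "\<theta> * (b - rel_entropy \<theta> p) \<le> \<theta> * (- ln s + (\<Sum>k\<in>W. (u k * exp (w k a * d True)) * v k))"
  proof (cases "s = 0")
    case False
    then show ?thesis using step[of True, folded s_def] st th by (intro mult_left_mono) auto
  qed (simp add: \<theta>_def)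
  have F: "(1 - \<theta>) * (b - rel_entropy \<theta> p) \<le> (1 - \<theta>) * (- ln t + (\<Sum>k\<in>W. (u k * exp (w k a * d False)) * v k))"
  proof (cases "t = 0")
    case False
    then show ?thesis using step[of False, folded t_def] st th by (intro mult_left_mono) auto
  qed (simp add: th1)
  have "b - rel_entropy \<theta> p \<le> \<theta> * (- ln s) + (1 - \<theta>) * (- ln t)
     + (\<theta> * (\<Sum>k\<in>W. (u k * exp (w k a * d True)) * v k) + (1 - \<theta>) * (\<Sum>k\<in>W. (u k * exp (w k a * d False)) * v k))"
    using T F by (simp add: algebra_simps)
  then show ?case using avg lnPA unfolding PA_def[symmetric] by linarith
qed

section \<open>Tangents to the entropy\<close>

text \<open>The logit. The derivative of \<open>rel_entropy\<close> in its first argument is a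
  difference of two of its values, so tangent questions become questions about this increasing
  function.\<close>

definition log_odds :: "real \<Rightarrow> real" where
  "log_odds x = ln x - ln (1 - x)"

lemma log_odds_mono: "0 < x \<Longrightarrow> x \<le> y \<Longrightarrow> y < 1 \<Longrightarrow> log_odds x \<le> log_odds y"
  unfolding log_odds_def by (intro diff_mono) auto

lemma log_odds_eq_ln: "0 < x \<Longrightarrow> x < 1 \<Longrightarrow> log_odds x = ln (x / (1 - x))"
  by (simp add: log_odds_def ln_div)

lemma DERIV_log_odds:
  assumes "0 < x" "x < 1"
  shows "(log_odds has_real_derivative 1 / (x * (1 - x))) (at x)"
proof -
  have "((\<lambda>x. ln x - ln (1 - x)) has_real_derivative 1 / x + 1 / (1 - x)) (at x)"
    using assms by (auto intro!: derivative_eq_intros)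
  moreover have "1 / x + 1 / (1 - x) = 1 / (x * (1 - x))"
    using assms by (simp add: field_simps)
  ultimately show ?thesis by (simp add: log_odds_def[abs_def])
qed

lemma DERIV_rel_entropy:
  assumes p: "0 < p" "p < 1" and x: "0 < x" "x < 1"
  shows "((\<lambda>r. rel_entropy r p) has_real_derivative log_odds x - log_odds p) (at x)"
proof -
  have "((\<lambda>r. r * (ln r - ln p) + (1 - r) * (ln (1 - r) - ln (1 - p))) has_real_derivative
      (ln x - ln p) - (ln (1 - x) - ln (1 - p))) (at x)"
    using x by (auto intro!: derivative_eq_intros)
  then have D: "((\<lambda>r. r * (ln r - ln p) + (1 - r) * (ln (1 - r) - ln (1 - p))) has_real_derivative
      log_odds x - log_odds p) (at x)"
    unfolding log_odds_def by (simp only: algebra_simps)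
  show ?thesis
    by (rule has_field_derivative_transform_within_open[OF D, of "{0<..<1}"])
      (use x p in \<open>auto simp: rel_entropy_interior\<close>)
qed

lemma rel_entropy_pos:
  assumes p: "0 < p" "p < 1" and r: "p < r" "r \<le> 1"
  shows "rel_entropy r p > 0"
proof (cases "r = 1")
  case True
  then show ?thesis using p by (simp add: rel_entropy_1)
next
  case False
  then have r: "p < r" "r < 1" using r by auto
  have "ln (p / r) < p / r - 1"
    using p r ln_le_minus_one[of "p / r"] ln_eq_minus_one[of "p / r"] by fastforce
  then have "r * (ln r - ln p) > r - p"
    using p r by (simp add: ln_div field_simps)
  moreover have "(1 - r) * (ln (1 - r) - ln (1 - p)) \<ge> p - r"
  proof -
    have "ln ((1 - p) / (1 - r)) \<le> (1 - p) / (1 - r) - 1"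
      using p r by (intro ln_le_minus_one) auto
    then have "(1 - r) * (ln (1 - p) - ln (1 - r)) \<le> (1 - r) * ((1 - p) / (1 - r) - 1)"
      using p r by (intro mult_left_mono) (auto simp: ln_div)
    also have "\<dots> = r - p" using r by (simp add: field_simps)
    finally show ?thesis by (simp add: algebra_simps)
  qed
  ultimately show ?thesis using p r by (simp add: rel_entropy_interior)
qed

lemma rel_entropy_mono:
  assumes p: "0 < p" "p < 1" and r: "p \<le> r" "r \<le> s" "s < 1"
  shows "rel_entropy r p \<le> rel_entropy s p"
  using r(2)
proof (rule DERIV_nonneg_imp_nondecreasing)
  fix x assume "r \<le> x" "x \<le> s"
  then show "\<exists>l. DERIV (\<lambda>r. rel_entropy r p) x :> l \<and> 0 \<le> l"
    using DERIV_rel_entropy[OF p, of x] log_odds_mono[of p x] p r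
    by (intro exI[of _ "log_odds x - log_odds p"]) auto
qed

text \<open>Dropping the nonpositive terms \<open>y * ln y\<close> and
  \<open>(1 - y) * ln (1 - y)\<close> leaves an affine function that agrees with
  \<open>rel_entropy\<close> at the endpoints 0 and 1.\<close>

lemma rel_entropy_le_linear:
  assumes "0 < p" "p < 1" "0 < y" "y < 1"
  shows "rel_entropy y p \<le> - y * ln p - (1 - y) * ln (1 - p)"
proof -
  have "y * ln y \<le> 0" "(1 - y) * ln (1 - y) \<le> 0"
    using assms by (auto intro!: mult_nonneg_nonpos)
  moreover have "rel_entropy y p = y * ln y + (1 - y) * ln (1 - y) - y * ln p - (1 - y) * ln (1 - p)"
    using assms by (simp add: rel_entropy_interior algebra_simps)
  ultimately show ?thesis by linarith
qed

text \<open>A supporting line at \<open>r\<close> for the entropy as a function of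
  \<open>y ^ d\<close>, that is, \<open>r ^ d\<close> lies on the lower convex envelope. The sign of
  the slope \<open>c\<close> matters because a lower bound on a sum of powers is going to be
  multiplied by it.\<close>

definition supported_at :: "real \<Rightarrow> nat \<Rightarrow> real \<Rightarrow> bool" where
  "supported_at p d r \<longleftrightarrow> (\<exists>c\<ge>0. \<forall>y\<in>{0..1}. rel_entropy r p + c * (y ^ d - r ^ d) \<le> rel_entropy y p)"

text \<open>Equal to \<open>d\<close> times the derivative of the entropy with respect to \<open>y ^ d\<close>.\<close>
definition entropy_slope :: "real \<Rightarrow> nat \<Rightarrow> real \<Rightarrow> real" where
  "entropy_slope p d y = (log_odds y - log_odds p) / y ^ (d - 1)"

text \<open>The inequality passes to the endpoints through the affine majorant of the entropy, which
  is continuous on the closed interval and exact at 0 and 1.\<close>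

lemma supported_at_interior:
  assumes p: "0 < p" "p < 1" and r: "p < r" "r < 1" and d: "d \<ge> 1" and c: "c \<ge> 0"
    and *: "\<And>y. 0 < y \<Longrightarrow> y < 1 \<Longrightarrow> rel_entropy r p + c * (y ^ d - r ^ d) \<le> rel_entropy y p"
  shows "supported_at p d r"
proof -
  let ?\<phi> = "\<lambda>y. - y * ln p - (1 - y) * ln (1 - p) - c * (y ^ d - r ^ d)"
  have \<phi>: "rel_entropy r p \<le> ?\<phi> y" if "0 \<le> y" "y \<le> 1" for y
  proof (rule continuous_ge_on_closure[of "{0<..<1}" ?\<phi>])
    show "continuous_on (closure {0<..<1}) ?\<phi>" by (intro continuous_intros)
    show "y \<in> closure {0<..<1}" using that by simp
    show "rel_entropy r p \<le> ?\<phi> z" if "z \<in> {0<..<1}" for z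
      using *[of z] rel_entropy_le_linear[OF p, of z] that by auto
  qed
  show ?thesis
    unfolding supported_at_def
  proof (rule exI[of _ c], intro conjI ballI)
    show "0 \<le> c" by (rule c)
  next
    fix y :: real assume y: "y \<in> {0..1}"
    consider "y = 0" | "y = 1" | "0 < y" "y < 1" using y by force
    then show "rel_entropy r p + c * (y ^ d - r ^ d) \<le> rel_entropy y p"
      using \<phi>[of y] * p by cases (auto simp: rel_entropy_0 rel_entropy_1)
  qed
qed

text \<open>The gap between entropy and tangent has derivative
  \<open>(entropy_slope p d y - entropy_slope p d r) * y ^ (d - 1)\<close>. So it decreases up to
  \<open>r\<close> and increases afterwards as soon as slopes compare correctly with the slope at
  \<open>r\<close>; convexity is more than is required. The bound \<open>s\<close> permits a tangent
  inequality valid only on an initial interval.\<close>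

lemma rel_entropy_tangent_local:
  assumes p: "0 < p" "p < 1" and r: "p < r" "r < 1" and d: "d \<ge> 1" and s: "r < s" "s \<le> 1"
    and below: "\<And>y. 0 < y \<Longrightarrow> y < r \<Longrightarrow> entropy_slope p d y \<le> entropy_slope p d r"
    and above: "\<And>y. r < y \<Longrightarrow> y < s \<Longrightarrow> entropy_slope p d y \<ge> entropy_slope p d r"
    and y: "0 < y" "y < s"
  shows "rel_entropy r p + entropy_slope p d r / real d * (y ^ d - r ^ d) \<le> rel_entropy y p"
proof -
  define g where "g = (\<lambda>y. rel_entropy y p - entropy_slope p d r / real d * y ^ d)"
  define g' where "g' = (\<lambda>y. log_odds y - log_odds p - entropy_slope p d r * y ^ (d - 1))"
  have g: "(g has_real_derivative g' y) (at y)" if "0 < y" "y < 1" for y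
    unfolding g_def g'_def using d that
    by (auto intro!: derivative_eq_intros DERIV_rel_entropy[OF p])
  have slope: "g' y = (entropy_slope p d y - entropy_slope p d r) * y ^ (d - 1)" if "0 < y" for y
    unfolding g'_def entropy_slope_def using that by (simp add: field_simps)
  have "g r \<le> g y"
  proof (cases "y \<le> r")
    case True
    then show ?thesis
    proof (rule DERIV_nonpos_imp_nonincreasing)
      fix z assume "y \<le> z" "z \<le> r"
      then show "\<exists>l. DERIV g z :> l \<and> l \<le> 0"
        using g[of z] below[of z] y r slope[of z] p
        by (cases "z = r") (auto intro!: exI[of _ "g' z"] mult_nonpos_nonneg)
    qed
  next
    case False
    then have "r \<le> y" by simp
    then show ?thesis
    proof (rule DERIV_nonneg_imp_nondecreasing)
      fix z assume "r \<le> z" "z \<le> y"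
      then show "\<exists>l. DERIV g z :> l \<and> 0 \<le> l"
        using g[of z] above[of z] y r slope[of z] p s
        by (cases "z = r") (auto intro!: exI[of _ "g' z"] mult_nonneg_nonneg)
    qed
  qed
  then show ?thesis unfolding g_def by (simp only: right_diff_distrib)
qed

text \<open>The numerator of the derivative of the slope factors as \<open>y ^ (d - 2)\<close> times
  the difference of the two sides of \<open>k\<close>, so \<open>k\<close> is precisely the sign
  condition for convexity in \<open>y ^ d\<close>.\<close>

lemma entropy_slope_mono:
  assumes p: "0 < p" "p < 1" and d: "d \<ge> 2" and uv: "0 < u" "u \<le> v" "v < 1"
    and k: "\<And>y. u \<le> y \<Longrightarrow> y \<le> v \<Longrightarrow> real (d - 1) * (log_odds y - log_odds p) \<le> 1 / (1 - y)"
  shows "entropy_slope p d u \<le> entropy_slope p d v"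
  using uv(2)
proof (rule DERIV_nonneg_imp_nondecreasing)
  fix y assume y: "u \<le> y" "y \<le> v"
  then have y01: "0 < y" "y < 1" using uv by auto
  obtain m where m: "d = Suc (Suc m)" using d by (metis Suc_le_D numeral_2_eq_2 Suc_le_mono)
  let ?L = "log_odds y - log_odds p"
  have "((\<lambda>y. y ^ (d - 1)) has_real_derivative real (d - 1) * y ^ m) (at y)"
    using m DERIV_pow[of "Suc m" y] by simp
  then have "(entropy_slope p d has_real_derivative
      (1 / (y * (1 - y)) * y ^ (d - 1) - ?L * (real (d - 1) * y ^ m)) / (y ^ (d - 1) * y ^ (d - 1))) (at y)"
    unfolding entropy_slope_def[abs_def] using y01
    by (intro DERIV_divide) (auto intro!: derivative_eq_intros DERIV_log_odds)
  moreover have "1 / (y * (1 - y)) * y ^ (d - 1) - ?L * (real (d - 1) * y ^ m)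
      = y ^ m * (1 / (1 - y) - real (d - 1) * ?L)"
    using y01 m by (simp add: field_simps)
  moreover have "y ^ m * (1 / (1 - y) - real (d - 1) * ?L) \<ge> 0"
    using k[OF y] y01 by (intro mult_nonneg_nonneg) auto
  ultimately show "\<exists>l. DERIV (entropy_slope p d) y :> l \<and> 0 \<le> l"
    using y01 by (metis divide_nonneg_pos mult_pos_pos zero_less_power)
qed

lemma entropy_slope_nonneg: "0 < p \<Longrightarrow> p < r \<Longrightarrow> r < 1 \<Longrightarrow> entropy_slope p d r \<ge> 0"
  unfolding entropy_slope_def using log_odds_mono[of p r] by simp

lemma supported_at_global:
  assumes p: "0 < p" "p < 1" and r: "p < r" "r < 1" and d: "d \<ge> 2"
    and below: "\<And>y. 0 < y \<Longrightarrow> y < r \<Longrightarrow> entropy_slope p d y \<le> entropy_slope p d r"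
    and above: "\<And>y. r < y \<Longrightarrow> y < 1 \<Longrightarrow> entropy_slope p d y \<ge> entropy_slope p d r"
  shows "supported_at p d r"
proof (rule supported_at_interior[OF p r])
  show "1 \<le> d" using d by simp
  show "0 \<le> entropy_slope p d r / real d" using entropy_slope_nonneg p r by simp
  show "rel_entropy r p + entropy_slope p d r / real d * (y ^ d - r ^ d) \<le> rel_entropy y p"
    if "0 < y" "y < 1" for y
    using d r by (intro rel_entropy_tangent_local[OF p r, where s = 1] below above that) auto
qed

text \<open>Origin of \<open>p_crit\<close>: in terms of the odds \<open>z = y / (1 - y)\<close> the
  sign condition reads \<open>D * (ln z - log_odds p) \<le> 1 + z\<close> with
  \<open>D = d - 1\<close>. The worst case is \<open>z = D\<close>, which leaves
  \<open>log_odds p \<ge> ln D - (D + 1) / D\<close>; solving for \<open>p\<close> gives the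
  critical value.\<close>

lemma supported_at_supercritical:
  assumes p: "0 < p" "p < 1" and r: "p < r" "r < 1" and d: "d \<ge> 2" and crit: "p > p_crit d"
  shows "supported_at p d r"
proof -
  define D where "D = real d - 1"
  have D: "D > 0" "real (d - 1) = D" "real d = D + 1" using d by (auto simp: D_def of_nat_diff)
  have k: "real (d - 1) * (log_odds y - log_odds p) \<le> 1 / (1 - y)" if y: "0 < y" "y < 1" for y
  proof -
    define e where "e = exp ((D + 1) / D)"
    have e: "e > 0" by (simp add: e_def)
    have "D / (D + e) < p" using crit unfolding p_crit_def D_def[symmetric] D(3) e_def by simp
    then have "D * (1 - p) < p * e" using D e by (simp add: field_simps)
    then have "ln (D * (1 - p)) < ln (p * e)" using D p e by (subst ln_less_cancel_iff) auto
    then have "ln D + ln (1 - p) < ln p + (D + 1) / D"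
      using D p e by (simp add: ln_mult e_def)
    then have "- log_odds p < (D + 1) / D - ln D" by (simp add: log_odds_def)
    then have 1: "D * (- log_odds p) \<le> D + 1 - D * ln D"
      using D by (simp add: field_simps)
    define z where "z = y / (1 - y)"
    have z: "z > 0" "1 / (1 - y) = 1 + z" using y by (auto simp: z_def field_simps)
    \<comment> \<open>The tangent to the logarithm at the worst point \<open>z = D\<close>.\<close>
    have "ln (z / D) \<le> z / D - 1" using z D by (intro ln_le_minus_one) auto
    then have "D * (ln z - ln D) \<le> D * (z / D - 1)"
      using D z by (intro mult_left_mono) (auto simp: ln_div)
    also have "D * (z / D - 1) = z - D" using D by (simp add: field_simps)
    finally have "D * ln z \<le> z - D + D * ln D" by (simp add: algebra_simps)
    then show ?thesis using 1 y z D unfolding log_odds_eq_ln[OF y] z_def[symmetric]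
      by (simp add: algebra_simps)
  qed
  show ?thesis
    using p r by (intro supported_at_global[OF p r d] entropy_slope_mono[OF p d] k) auto
qed

text \<open>Two ranges of \<open>y\<close> are treated separately. Up to some \<open>s > p\<close>
  the slope is increasing, so the tangent lies below. Beyond \<open>s\<close> the entropy is at
  least \<open>rel_entropy s p > 0\<close>, while the tangent at \<open>r\<close> tends uniformly to
  zero as \<open>r\<close> decreases to \<open>p\<close>.\<close>

lemma supported_at_near_p:
  assumes p: "0 < p" "p < 1" and d: "d \<ge> 2"
  shows "\<exists>p'>p. p' < 1 \<and> (\<forall>r\<in>{p<..<p'}. supported_at p d r)"
proof -
  \<comment> \<open>At \<open>p\<close> the log odds cancel and leave
    \<open>1 / (1 - p) > 0\<close>, so continuity carries the sign condition slightly beyond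
    \<open>p\<close>; below \<open>p\<close> the subtracted term is nonpositive.\<close>
  define k where "k = (\<lambda>y. 1 / (1 - y) - real (d - 1) * (log_odds y - log_odds p))"
  have L: "isCont log_odds p" using DERIV_log_odds[OF p] DERIV_isCont by blast
  have "isCont k p" unfolding k_def using p L by (auto intro!: continuous_intros)
  then have "(k \<longlongrightarrow> k p) (at_right p)"
    unfolding isCont_def by (rule tendsto_mono[rotated]) (simp add: at_within_le_at)
  moreover have "k p > 0" using p by (simp add: k_def)
  ultimately have "eventually (\<lambda>y. k y > 0) (at_right p)" by (rule order_tendstoD(1))
  then obtain b where b: "b > p" "\<And>y. p < y \<Longrightarrow> y < b \<Longrightarrow> k y > 0"
    unfolding eventually_at_right_field by blast
  define s where "s = (p + min b 1) / 2"
  have s: "p < s" "s < b" "s < 1" using p b by (auto simp: s_def)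
  have k: "real (d - 1) * (log_odds y - log_odds p) \<le> 1 / (1 - y)" if y: "0 < y" "y \<le> s" for y
  proof (cases "y \<le> p")
    case True
    then have "real (d - 1) * (log_odds y - log_odds p) \<le> 0"
      using log_odds_mono[of y p] y p by (intro mult_nonneg_nonpos) auto
    also have "0 \<le> 1 / (1 - y)" using y s by simp
    finally show ?thesis .
  next
    case False
    then show ?thesis using b(2)[of y] y s by (simp add: k_def)
  qed
  \<comment> \<open>With \<open>L\<close> the difference of log odds at \<open>r\<close> and
    \<open>p\<close>, the tangent has value at most \<open>L\<close> at \<open>r\<close> and slope
    at most \<open>L / p ^ (d - 1)\<close>, hence it stays below \<open>L * M\<close> on the unit
    interval.\<close>
  define M where "M = 1 + 1 / p ^ (d - 1)"
  have "isCont (\<lambda>r. (log_odds r - log_odds p) * M) p"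
    using L by (auto intro!: continuous_intros)
  then have "((\<lambda>r. (log_odds r - log_odds p) * M) \<longlongrightarrow> (log_odds p - log_odds p) * M) (at_right p)"
    unfolding isCont_def by (rule tendsto_mono[rotated]) (simp add: at_within_le_at)
  moreover have "(log_odds p - log_odds p) * M < rel_entropy s p"
    using rel_entropy_pos[OF p, of s] s by simp
  ultimately have "eventually (\<lambda>r. (log_odds r - log_odds p) * M < rel_entropy s p) (at_right p)"
    by (rule order_tendstoD(2))
  then obtain b' where b': "b' > p" "\<And>y. p < y \<Longrightarrow> y < b' \<Longrightarrow> (log_odds y - log_odds p) * M < rel_entropy s p"
    unfolding eventually_at_right_field by blast
  have "supported_at p d r" if r: "p < r" "r < min s b'" for r
  proof (rule supported_at_interior[OF p])
    show "p < r" "r < 1" "1 \<le> d" using r s d by auto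
    let ?c = "entropy_slope p d r / real d"
    show c: "0 \<le> ?c" using entropy_slope_nonneg[of p r d] p r s by simp
    fix y assume y: "0 < y" "y < (1::real)"
    show "rel_entropy r p + ?c * (y ^ d - r ^ d) \<le> rel_entropy y p"
    proof (cases "y < s")
      case True
      show ?thesis
        using d r s p y True
        by (intro rel_entropy_tangent_local[OF p, where s = s] entropy_slope_mono[OF p d] k) auto
    next
      case False
      let ?L = "log_odds r - log_odds p"
      have L0: "?L \<ge> 0" using log_odds_mono[of p r] p r s by simp
      have 1: "rel_entropy r p \<le> ?L"
      proof -
        have "(1 - r) * (ln r - ln p) \<ge> 0" "(2 - r) * (ln (1 - p) - ln (1 - r)) \<ge> 0"
          using p r s by (auto intro!: mult_nonneg_nonneg)
        then show ?thesis using p r s by (simp add: rel_entropy_interior log_odds_def algebra_simps)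
      qed
      have 2: "?c \<le> ?L / p ^ (d - 1)"
      proof -
        have "?c \<le> entropy_slope p d r / 1"
          using d entropy_slope_nonneg[of p r d] p r s by (intro divide_left_mono) auto
        also have "\<dots> \<le> ?L / p ^ (d - 1)"
          unfolding entropy_slope_def using L0 p r
          by (simp, intro divide_left_mono power_mono) auto
        finally show ?thesis .
      qed
      have "y ^ d - r ^ d \<le> 1" using y p r s power_le_one[of y d] zero_le_power[of r d] by linarith
      then have "?c * (y ^ d - r ^ d) \<le> ?c" using c mult_left_mono by fastforce
      then have "rel_entropy r p + ?c * (y ^ d - r ^ d) \<le> ?L * M"
        using 1 2 by (simp add: M_def algebra_simps)
      also have "\<dots> \<le> rel_entropy s p" using b'(2)[of r] r by simp
      also have "\<dots> \<le> rel_entropy y p" using False p s y by (intro rel_entropy_mono) auto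
      finally show ?thesis .
    qed
  qed
  then show ?thesis using s b' by (intro exI[of _ "min s b'"]) auto
qed

text \<open>The slope is increasing on some interval up to 1, bounded by a constant \<open>M\<close>
  to the left of it, and unbounded at 1. Once the slope at \<open>r\<close> exceeds
  \<open>M\<close>, all slopes to the left of \<open>r\<close> are smaller and all to the right are
  larger.\<close>

lemma supported_at_near_1:
  assumes p: "0 < p" "p < 1" and d: "d \<ge> 2"
  shows "\<exists>p''<1. \<forall>r\<in>{p<..<1}. p'' < r \<longrightarrow> supported_at p d r"
proof -
  define D where "D = real d - 1"
  have D: "D > 0" "real (d - 1) = D" using d by (auto simp: D_def of_nat_diff)
  \<comment> \<open>Half of the odds \<open>z\<close> dominates the logarithm, by its tangent at
    \<open>z = 2 * D\<close>; the other half pays for the remaining constant as soon as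
    \<open>z \<ge> Z\<close>.\<close>
  define Z where "Z = 2 * \<bar>D * ln (2 * D) - D * log_odds p\<bar>"
  have k: "real (d - 1) * (log_odds y - log_odds p) \<le> 1 / (1 - y)"
    if y: "0 < y" "y < 1" "Z \<le> y / (1 - y)" for y
  proof -
    define z where "z = y / (1 - y)"
    have z: "z > 0" "1 / (1 - y) = 1 + z" "Z \<le> z" using y by (auto simp: z_def field_simps)
    have "ln (z / (2 * D)) \<le> z / (2 * D) - 1" using z D by (intro ln_le_minus_one) auto
    then have "D * (ln z - ln (2 * D)) \<le> D * (z / (2 * D) - 1)"
      using D z by (intro mult_left_mono) (auto simp: ln_div)
    also have "D * (z / (2 * D) - 1) = z / 2 - D" using D by (simp add: field_simps)
    finally have "D * ln z \<le> z / 2 - D + D * ln (2 * D)" by (simp add: algebra_simps)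
    moreover have "D * ln (2 * D) - D * log_odds p \<le> z / 2" 
    proof -
      have "a \<le> z / 2" if "2 * \<bar>a\<bar> \<le> z" for a :: real using that by linarith
      then show ?thesis using z(3) unfolding Z_def by blast
    qed
    ultimately show ?thesis using z D unfolding log_odds_eq_ln[OF y(1,2)] z_def[symmetric]
      by (simp add: algebra_simps)
  qed
  define y1 where "y1 = max p (Z / (1 + Z))"
  have Z0: "Z \<ge> 0" by (simp add: Z_def)
  have y1: "0 < y1" "p \<le> y1" "y1 < 1" using p Z0 by (auto simp: y1_def)
  have odds: "M \<le> y / (1 - y)" if "M / (1 + M) \<le> y" "M \<ge> 0" "y < 1" for M y :: real
    using that by (simp add: field_simps)
  have mono: "entropy_slope p d u \<le> entropy_slope p d v" if uv: "y1 \<le> u" "u \<le> v" "v < 1" for u v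
  proof (rule entropy_slope_mono[OF p d])
    fix y assume "u \<le> y" "y \<le> v"
    then show "real (d - 1) * (log_odds y - log_odds p) \<le> 1 / (1 - y)"
      using uv y1 Z0 by (intro k odds) (auto simp: y1_def)
  qed (use uv y1 in auto)
  \<comment> \<open>Bounds the slope on the stretch from \<open>p\<close> to \<open>y1\<close>:
    largest numerator over smallest denominator. Below \<open>p\<close> the slope is
    nonpositive.\<close>
  define M where "M = (log_odds y1 - log_odds p) / p ^ (d - 1)"
  have M0: "M \<ge> 0" using log_odds_mono[of p y1] p y1 by (simp add: M_def)
  \<comment> \<open>The odds at which the log odds exceed those of \<open>p\<close> by exactly
    \<open>M\<close>. Since \<open>r ^ (d - 1) \<le> 1\<close>, the slope at \<open>r\<close> is at
    least this excess.\<close>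
  define N where "N = exp (M + log_odds p)"
  have N0: "N > 0" by (simp add: N_def)
  define p'' where "p'' = max y1 (N / (1 + N))"
  have "supported_at p d r" if r: "p < r" "r < 1" "p'' < r" for r
  proof (rule supported_at_global[OF p r(1,2) d])
    fix y assume "r < y" "y < 1"
    then show "entropy_slope p d r \<le> entropy_slope p d y"
      using r by (intro mono) (auto simp: p''_def)
  next
    fix y assume y: "0 < y" "y < r"
    show "entropy_slope p d y \<le> entropy_slope p d r"
    proof (cases "y1 \<le> y")
      case True
      then show ?thesis using y r by (intro mono) auto
    next
      case False
      have "entropy_slope p d y \<le> M"
      proof (cases "y \<le> p")
        case True
        then have "log_odds y - log_odds p \<le> 0" using log_odds_mono[of y p] y p by simp
        then have "entropy_slope p d y \<le> 0"
          unfolding entropy_slope_def using y by (simp add: divide_nonpos_pos)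
        then show ?thesis using M0 by simp
      next
        case y': False
        show ?thesis
          unfolding entropy_slope_def M_def
          using False y' y p y1 log_odds_mono[of y y1] log_odds_mono[of p y]
          by (intro frac_le power_mono) auto
      qed
      also have "M \<le> log_odds r - log_odds p"
      proof -
        have "N \<le> r / (1 - r)" using r N0 by (intro odds) (auto simp: p''_def)
        then have "ln N \<le> ln (r / (1 - r))" using N0 by simp
        then show ?thesis using r p by (simp add: log_odds_eq_ln N_def)
      qed
      also have "\<dots> \<le> entropy_slope p d r"
        unfolding entropy_slope_def
        using log_odds_mono[of p r] p r power_le_one[of r "d - 1"]
        by (simp add: le_divide_eq mult_left_le)
      finally show ?thesis .
    qed
  qed
  moreover have "p'' < 1" using y1 N0 by (auto simp: p''_def)
  ultimately show ?thesis by (intro exI[of _ p'']) auto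
qed

section \<open>Homomorphism polynomials and the cut norm\<close>

definition inj_tuples :: "'a set \<Rightarrow> nat \<Rightarrow> ('a \<Rightarrow> nat) set" where
  "inj_tuples V n = {t \<in> V \<rightarrow>\<^sub>E {1..n}. inj_on t V}"

text \<open>The weight may depend on the edge of the pattern, so that one weight function can be
  exchanged for another one pattern edge at a time.\<close>

definition hom_poly :: "'a set \<Rightarrow> 'a set set \<Rightarrow> nat \<Rightarrow> ('a set \<Rightarrow> nat set \<Rightarrow> real) \<Rightarrow> real" where
  "hom_poly V E n Y = (\<Sum>t\<in>inj_tuples V n. \<Prod>e\<in>E. Y e (t ` e))"

text \<open>The form tested by the cut norm. It runs over ordered pairs, so an edge inside both
  \<open>S\<close> and \<open>T\<close> counts twice.\<close>

definition pair_sum :: "(nat set \<Rightarrow> real) \<Rightarrow> nat set \<Rightarrow> nat set \<Rightarrow> real" where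
  "pair_sum B S T = (\<Sum>i\<in>S. \<Sum>j\<in>T. if i = j then 0 else B {i, j})"

lemma finite_inj_tuples [simp]: "finite V \<Longrightarrow> finite (inj_tuples V n)"
  unfolding inj_tuples_def by (rule finite_subset[of _ "V \<rightarrow>\<^sub>E {1..n}"]) (auto intro!: finite_PiE)

lemma card_inj_tuples:
  assumes "finite V"
  shows "card (inj_tuples V n) = fact (card V) * (n choose card V)"
proof -
  have "card (inj_tuples V n) = prod ((-) n) {0..<card V}"
    unfolding inj_tuples_def using card_inj_on_subset_funcset[of V "{1..n}" V] assms by simp
  also have "prod ((-) n) {0..<k} = fact k * (n choose k)" for k
  proof (induction k)
    case (Suc k)
    have "prod ((-) n) {0..<Suc k} = fact k * ((n - k) * (n choose k))"
      using Suc by (simp add: mult_ac)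
    also have "(n - k) * (n choose k) = Suc k * (n choose Suc k)"
      by (simp only: binomial_absorb_comp binomial_absorption)
    finally show ?case by (simp only: fact_Suc of_nat_id mult_ac)
  qed simp
  finally show ?thesis .
qed

lemma card_inj_tuples_le: "finite V \<Longrightarrow> card (inj_tuples V n) \<le> n ^ card V"
  using card_mono[of "V \<rightarrow>\<^sub>E {1..n}" "inj_tuples V n"]
  by (auto simp: card_PiE inj_tuples_def intro!: finite_PiE)

text \<open>A linear form on the unit cube is maximal at a vertex, namely the indicator of its
  positive coefficients.\<close>

lemma linear_form_le_subset:
  fixes \<alpha> c :: "'i \<Rightarrow> real"
  assumes "finite R" "\<And>i. i \<in> R \<Longrightarrow> 0 \<le> \<alpha> i \<and> \<alpha> i \<le> 1"
  shows "\<exists>S\<subseteq>R. (\<Sum>i\<in>R. \<alpha> i * c i) \<le> (\<Sum>i\<in>S. c i)"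
proof -
  let ?S = "{i \<in> R. c i > 0}"
  have "(\<Sum>i\<in>R. \<alpha> i * c i) \<le> (\<Sum>i\<in>R. if c i > 0 then c i else 0)"
  proof (rule sum_mono)
    fix i assume "i \<in> R"
    then show "\<alpha> i * c i \<le> (if c i > 0 then c i else 0)"
      using assms(2)[of i] by (cases "c i > 0") (simp_all add: mult_left_le_one_le mult_nonneg_nonpos)
  qed
  also have "\<dots> = (\<Sum>i\<in>?S. c i)"
    by (rule sum.inter_filter[OF assms(1), symmetric])
  finally show ?thesis by (intro exI[of _ ?S]) auto
qed

text \<open>With one argument fixed the form is linear in the other, so the weights are rounded to
  indicators one argument at a time.\<close>

lemma bilinear_form_le_subset:
  fixes \<alpha> \<beta> :: "'i \<Rightarrow> real" and b :: "'i \<Rightarrow> 'i \<Rightarrow> real"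
  assumes "finite R" "\<And>i. i \<in> R \<Longrightarrow> 0 \<le> \<alpha> i \<and> \<alpha> i \<le> 1" "\<And>i. i \<in> R \<Longrightarrow> 0 \<le> \<beta> i \<and> \<beta> i \<le> 1"
  shows "\<exists>S\<subseteq>R. \<exists>T\<subseteq>R. (\<Sum>i\<in>R. \<Sum>j\<in>R. \<alpha> i * \<beta> j * b i j) \<le> (\<Sum>i\<in>S. \<Sum>j\<in>T. b i j)"
proof -
  have "\<exists>S\<subseteq>R. (\<Sum>i\<in>R. \<alpha> i * (\<Sum>j\<in>R. \<beta> j * b i j)) \<le> (\<Sum>i\<in>S. \<Sum>j\<in>R. \<beta> j * b i j)"
    by (rule linear_form_le_subset) (use assms in auto)
  then obtain S where S: "S \<subseteq> R"
    "(\<Sum>i\<in>R. \<alpha> i * (\<Sum>j\<in>R. \<beta> j * b i j)) \<le> (\<Sum>i\<in>S. \<Sum>j\<in>R. \<beta> j * b i j)"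
    by blast
  have "\<exists>T\<subseteq>R. (\<Sum>j\<in>R. \<beta> j * (\<Sum>i\<in>S. b i j)) \<le> (\<Sum>j\<in>T. \<Sum>i\<in>S. b i j)"
    by (rule linear_form_le_subset) (use assms in auto)
  then obtain T where T: "T \<subseteq> R"
    "(\<Sum>j\<in>R. \<beta> j * (\<Sum>i\<in>S. b i j)) \<le> (\<Sum>j\<in>T. \<Sum>i\<in>S. b i j)"
    by blast
  have "(\<Sum>i\<in>S. \<Sum>j\<in>R. \<beta> j * b i j) = (\<Sum>j\<in>R. \<beta> j * (\<Sum>i\<in>S. b i j))"
    by (simp add: sum_distrib_left sum.swap[of _ S])
  moreover have "(\<Sum>j\<in>T. \<Sum>i\<in>S. b i j) = (\<Sum>i\<in>S. \<Sum>j\<in>T. b i j)"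
    by (rule sum.swap)
  moreover have "(\<Sum>i\<in>R. \<alpha> i * (\<Sum>j\<in>R. \<beta> j * b i j)) = (\<Sum>i\<in>R. \<Sum>j\<in>R. \<alpha> i * \<beta> j * b i j)"
    by (simp add: sum_distrib_left mult.assoc)
  ultimately show ?thesis using S T by (intro exI[of _ S] exI[of _ T] conjI) auto
qed

lemma pair_sum_uminus: "pair_sum (\<lambda>f. - B f) S T = - pair_sum B S T"
  unfolding pair_sum_def by (simp add: sum_negf[symmetric] if_distrib cong: if_cong)

lemma weighted_pair_sum_le:
  assumes "finite R" "\<And>i. i \<in> R \<Longrightarrow> 0 \<le> \<alpha> i \<and> \<alpha> i \<le> 1" "\<And>i. i \<in> R \<Longrightarrow> 0 \<le> \<beta> i \<and> \<beta> i \<le> 1"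
    and D: "\<And>S T. S \<subseteq> R \<Longrightarrow> T \<subseteq> R \<Longrightarrow> \<bar>pair_sum B S T\<bar> \<le> D"
  shows "\<bar>\<Sum>i\<in>R. \<Sum>j\<in>R. \<alpha> i * \<beta> j * (if i = j then 0 else B {i, j})\<bar> \<le> D"
proof -
  have le: "(\<Sum>i\<in>R. \<Sum>j\<in>R. \<alpha> i * \<beta> j * (if i = j then 0 else C {i, j})) \<le> D"
    if C: "\<And>S T. S \<subseteq> R \<Longrightarrow> T \<subseteq> R \<Longrightarrow> pair_sum C S T \<le> D" for C
  proof -
    have "\<exists>S\<subseteq>R. \<exists>T\<subseteq>R. (\<Sum>i\<in>R. \<Sum>j\<in>R. \<alpha> i * \<beta> j * (if i = j then 0 else C {i, j})) \<le> pair_sum C S T"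
      unfolding pair_sum_def by (rule bilinear_form_le_subset) (use assms in auto)
    then show ?thesis using C by (meson order_trans)
  qed
  have "(\<Sum>i\<in>R. \<Sum>j\<in>R. \<alpha> i * \<beta> j * (if i = j then 0 else - B {i, j}))
      = - (\<Sum>i\<in>R. \<Sum>j\<in>R. \<alpha> i * \<beta> j * (if i = j then 0 else B {i, j}))"
    by (simp add: sum_negf[symmetric] if_distrib cong: if_cong)
  moreover have "\<dots> \<le> D"
    unfolding calculation[symmetric]
    by (rule le) (use D in \<open>auto simp: pair_sum_uminus abs_le_iff\<close>)
  moreover have "(\<Sum>i\<in>R. \<Sum>j\<in>R. \<alpha> i * \<beta> j * (if i = j then 0 else B {i, j})) \<le> D"
    by (rule le) (use D in \<open>auto simp: abs_le_iff\<close>)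
  ultimately show ?thesis by (simp add: abs_le_iff)
qed

text \<open>All vertices but \<open>a\<close> and \<open>b\<close> are placed first. The images of
  \<open>a\<close> and \<open>b\<close> then range over the same set of free vertices, with the
  diagonal set to zero, which has the shape of a bilinear form.\<close>

lemma sum_inj_tuples_split:
  fixes F :: "('a \<Rightarrow> nat) \<Rightarrow> real"
  assumes V: "finite V" and ab: "a \<in> V" "b \<in> V" "a \<noteq> b"
  shows "(\<Sum>t\<in>inj_tuples V n. F t) =
    (\<Sum>s\<in>inj_tuples (V - {a, b}) n.
      \<Sum>i\<in>{1..n} - s ` (V - {a, b}). \<Sum>j\<in>{1..n} - s ` (V - {a, b}). if i = j then 0 else F (s(a := i, b := j)))"
proof -
  let ?U = "V - {a, b}"
  let ?R = "\<lambda>s. {1..n} - s ` ?U"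
  let ?Z = "SIGMA s:inj_tuples ?U n. ({(i, j). i \<in> ?R s \<and> j \<in> ?R s \<and> i \<noteq> j})"
  have fin: "finite {(i, j). i \<in> ?R s \<and> j \<in> ?R s \<and> i \<noteq> j}" for s
    by (rule finite_subset[of _ "{1..n} \<times> {1..n}"]) auto
  have inner: "(\<Sum>i\<in>?R s. \<Sum>j\<in>?R s. if i = j then 0 else F (s(a := i, b := j)))
     = (\<Sum>(i, j)\<in>{(i, j). i \<in> ?R s \<and> j \<in> ?R s \<and> i \<noteq> j}. F (s(a := i, b := j)))" for s
  proof -
    have "(\<Sum>i\<in>?R s. \<Sum>j\<in>?R s. if i = j then 0 else F (s(a := i, b := j)))
        = (\<Sum>(i, j)\<in>?R s \<times> ?R s. if i = j then 0 else F (s(a := i, b := j)))"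
      by (simp add: sum.cartesian_product)
    also have "\<dots> = (\<Sum>(i, j)\<in>{(i, j). i \<in> ?R s \<and> j \<in> ?R s \<and> i \<noteq> j}. F (s(a := i, b := j)))"
      by (rule sum.mono_neutral_cong_right) (auto split: if_splits)
    finally show ?thesis .
  qed
  have "(\<Sum>t\<in>inj_tuples V n. F t) = (\<Sum>(s, i, j)\<in>?Z. F (s(a := i, b := j)))"
  proof (rule sum.reindex_bij_witness[of _ "\<lambda>(s, i, j). s(a := i, b := j)"
        "\<lambda>t. (restrict t ?U, t a, t b)"], goal_cases)
    case (1 t)
    then show ?case using ab by (auto simp: inj_tuples_def fun_eq_iff PiE_def extensional_def)
  next
    case (2 t)
    then show ?case using ab by (auto simp: inj_tuples_def inj_on_def PiE_def Pi_def)
  next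
    case (3 z)
    obtain s i j where z: "z = (s, i, j)" by (cases z)
    have "s x = undefined" if "x \<notin> ?U" for x
      using 3 z that by (auto simp: inj_tuples_def PiE_def extensional_def)
    then have "restrict (s(a := i, b := j)) ?U = s"
      by (intro ext) (simp add: restrict_def)
    then show ?case using ab z by simp
  next
    case (4 z)
    obtain s i j where z: "z = (s, i, j)" by (cases z)
    have s: "s \<in> ?U \<rightarrow>\<^sub>E {1..n}" "inj_on s ?U" and ij: "i \<in> ?R s" "j \<in> ?R s" "i \<noteq> j"
      using 4 z by (auto simp: inj_tuples_def)
    let ?t = "s(a := i, b := j)"
    have U: "?t x = s x" "s x \<in> {1..n}" "s x \<noteq> i" "s x \<noteq> j" if x: "x \<in> ?U" for x
    proof -
      show "?t x = s x" using x by simp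
      show "s x \<in> {1..n}" using s(1) x by (rule PiE_mem)
      have "s x \<in> s ` ?U" using x by (rule imageI)
      then show "s x \<noteq> i" "s x \<noteq> j" using ij(1,2) by blast+
    qed
    have V: "x \<in> ?U \<or> x = a \<or> x = b" if "x \<in> V" for x using that by auto
    have t: "?t a = i" "?t b = j" using ab by auto
    have "?t x \<in> {1..n}" if "x \<in> V" for x
      using V[OF that] U t ij by (metis DiffD1)
    moreover have "?t x = undefined" if "x \<notin> V" for x
      using that s ab by (auto simp: PiE_def extensional_def)
    moreover have "inj_on ?t V"
    proof (rule inj_onI)
      fix x y assume xy: "x \<in> V" "y \<in> V" "?t x = ?t y"
      then show "x = y" using V[OF xy(1)] V[OF xy(2)] U t ij(3) s(2)
        by (metis inj_onD)
    qed
    ultimately show ?case using z by (auto simp: inj_tuples_def PiE_def extensional_def simp del: fun_upd_apply)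
  next
    case (5 t)
    then have "(restrict t ?U)(a := t a, b := t b) = t"
      using ab by (auto simp: inj_tuples_def fun_eq_iff PiE_def extensional_def)
    then show ?case by simp
  qed
  also have "\<dots> = (\<Sum>s\<in>inj_tuples ?U n. \<Sum>(i, j)\<in>{(i, j). i \<in> ?R s \<and> j \<in> ?R s \<and> i \<noteq> j}. F (s(a := i, b := j)))"
    using V fin by (subst sum.Sigma[symmetric]) (auto simp: split_def)
  finally show ?thesis by (simp only: inner)
qed

lemma edgeE:
  assumes "e \<in> nsets V 2"
  obtains a b where "e = {a, b}" "a \<in> V" "b \<in> V" "a \<noteq> b"
  using assms by (auto simp: nsets_def card_2_iff)

text \<open>With all vertices but the ends \<open>a\<close>, \<open>b\<close> of \<open>e0\<close>
  placed, no other edge contains both ends. The product therefore splits into a function of the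
  image of \<open>a\<close> times one of the image of \<open>b\<close>, and the cut norm bounds the
  bilinear form. At most \<open>n ^ (card V - 2)\<close> placements remain.\<close>

lemma hom_poly_change_edge:
  assumes V: "finite V" and E: "E \<subseteq> nsets V 2" and e0: "e0 \<in> E"
    and Y: "\<And>e f. 0 \<le> Y e f \<and> Y e f \<le> 1"
    and D: "\<And>S T. S \<subseteq> {1..n} \<Longrightarrow> T \<subseteq> {1..n} \<Longrightarrow> \<bar>pair_sum B S T\<bar> \<le> D"
  shows "\<bar>\<Sum>t\<in>inj_tuples V n. B (t ` e0) * (\<Prod>e\<in>E - {e0}. Y e (t ` e))\<bar> \<le> real n ^ (card V - 2) * D"
proof -
  obtain a b where ab: "e0 = {a, b}" "a \<in> V" "b \<in> V" "a \<noteq> b"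
    using E e0 edgeE by (metis subsetD)
  let ?U = "V - {a, b}"
  let ?R = "\<lambda>s. {1..n} - s ` ?U"
  have finE: "finite E"
    using V E finite_subset finite_imp_finite_nsets by blast
  \<comment> \<open>Edges through \<open>a\<close> go to \<open>\<alpha>\<close>; all others,
    including those that avoid both ends, go to \<open>\<beta>\<close>.\<close>
  define \<alpha> where "\<alpha> = (\<lambda>s i. \<Prod>e\<in>{e \<in> E - {e0}. a \<in> e}. Y e ((s(a := i)) ` e))"
  define \<beta> where "\<beta> = (\<lambda>s j. \<Prod>e\<in>{e \<in> E - {e0}. a \<notin> e}. Y e ((s(b := j)) ` e))"
  have split: "(\<Prod>e\<in>E - {e0}. Y e ((s(a := i, b := j)) ` e)) = \<alpha> s i * \<beta> s j" for s i j
  proof -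
    have "(\<Prod>e\<in>E - {e0}. Y e ((s(a := i, b := j)) ` e))
        = (\<Prod>e\<in>{e \<in> E - {e0}. a \<in> e}. Y e ((s(a := i, b := j)) ` e))
         * (\<Prod>e\<in>{e \<in> E - {e0}. a \<notin> e}. Y e ((s(a := i, b := j)) ` e))"
      using finE by (subst prod.union_disjoint[symmetric]) (auto intro!: prod.cong)
    also have "(\<Prod>e\<in>{e \<in> E - {e0}. a \<in> e}. Y e ((s(a := i, b := j)) ` e)) = \<alpha> s i"
      unfolding \<alpha>_def
    proof (rule prod.cong[OF refl])
      fix e assume e: "e \<in> {e \<in> E - {e0}. a \<in> e}"
      have "b \<notin> e"
      proof
        assume "b \<in> e"
        then have "{a, b} \<subseteq> e" "card e = 2" "finite e" using e E by (auto simp: nsets_def)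
        then have "e = {a, b}" using ab by (metis card_2_iff card_subset_eq)
        then show False using e ab by auto
      qed
      then show "Y e ((s(a := i, b := j)) ` e) = Y e ((s(a := i)) ` e)"
        by (intro arg_cong[of _ _ "Y e"] image_cong) auto
    qed
    also have "(\<Prod>e\<in>{e \<in> E - {e0}. a \<notin> e}. Y e ((s(a := i, b := j)) ` e)) = \<beta> s j"
      unfolding \<beta>_def
      by (intro prod.cong refl arg_cong[of _ _ "Y _"] image_cong) auto
    finally show ?thesis .
  qed
  have unit: "0 \<le> \<alpha> s i \<and> \<alpha> s i \<le> 1" "0 \<le> \<beta> s i \<and> \<beta> s i \<le> 1" for s i
    unfolding \<alpha>_def \<beta>_def using Y by (auto intro!: prod_nonneg prod_le_1)
  have "\<bar>\<Sum>t\<in>inj_tuples V n. B (t ` e0) * (\<Prod>e\<in>E - {e0}. Y e (t ` e))\<bar>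
     = \<bar>\<Sum>s\<in>inj_tuples ?U n. \<Sum>i\<in>?R s. \<Sum>j\<in>?R s. \<alpha> s i * \<beta> s j * (if i = j then 0 else B {i, j})\<bar>"
    unfolding sum_inj_tuples_split[OF V ab(2-4)] split
    using ab by (intro arg_cong[of _ _ abs] sum.cong refl) auto
  also have "\<dots> \<le> (\<Sum>s\<in>inj_tuples ?U n. \<bar>\<Sum>i\<in>?R s. \<Sum>j\<in>?R s. \<alpha> s i * \<beta> s j * (if i = j then 0 else B {i, j})\<bar>)"
    by (rule sum_abs)
  also have "\<dots> \<le> (\<Sum>s\<in>inj_tuples ?U n. D)"
    by (intro sum_mono weighted_pair_sum_le unit) (auto intro!: D)
  also have "\<dots> = real (card (inj_tuples ?U n)) * D" by simp
  also have "\<dots> \<le> real n ^ (card V - 2) * D"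
  proof (rule mult_right_mono)
    have "card ?U = card V - 2" using V ab by (simp add: card_Diff_subset)
    then show "real (card (inj_tuples ?U n)) \<le> real n ^ (card V - 2)"
      using card_inj_tuples_le[of ?U n] V by (metis finite_Diff of_nat_le_iff of_nat_power)
    show "0 \<le> D" using D[of "{}" "{}"] by (simp add: pair_sum_def)
  qed
  finally show ?thesis .
qed

text \<open>The counting lemma for the cut norm, by telescoping: \<open>x\<close> replaces
  \<open>y\<close> on one pattern edge at a time, through the hybrid weights
  \<open>Y\<close>.\<close>

lemma hom_poly_cut_continuity:
  assumes V: "finite V" and E: "E \<subseteq> nsets V 2"
    and x: "\<And>f. 0 \<le> x f \<and> x f \<le> (1::real)" and y: "\<And>f. 0 \<le> y f \<and> y f \<le> (1::real)"
    and D: "\<And>S T. S \<subseteq> {1..n} \<Longrightarrow> T \<subseteq> {1..n} \<Longrightarrow> \<bar>pair_sum (\<lambda>f. x f - y f) S T\<bar> \<le> D"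
  shows "\<bar>hom_poly V E n (\<lambda>_. x) - hom_poly V E n (\<lambda>_. y)\<bar> \<le> real (card E) * (real n ^ (card V - 2) * D)"
proof -
  have finE: "finite E"
    using V E finite_subset finite_imp_finite_nsets by blast
  define Y where "Y = (\<lambda>(D :: 'a set set) e. if e \<in> D then x else y)"
  have "\<bar>hom_poly V E n (Y D') - hom_poly V E n (\<lambda>_. y)\<bar> \<le> real (card D') * (real n ^ (card V - 2) * D)"
    if "D' \<subseteq> E" for D'
    using finite_subset[OF that finE] that
  proof (induction D' rule: finite_induct)
    case empty
    then show ?case by (simp add: Y_def)
  next
    case (insert e0 D')
    have e0: "e0 \<in> E" using insert by auto
    have "(\<Prod>e\<in>E. Y (insert e0 D') e (t ` e)) - (\<Prod>e\<in>E. Y D' e (t ` e))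
        = (x (t ` e0) - y (t ` e0)) * (\<Prod>e\<in>E - {e0}. Y D' e (t ` e))" for t :: "'a \<Rightarrow> nat"
    proof -
      have "(\<Prod>e\<in>E - {e0}. Y (insert e0 D') e (t ` e)) = (\<Prod>e\<in>E - {e0}. Y D' e (t ` e))"
        by (intro prod.cong) (auto simp: Y_def)
      then show ?thesis
        using prod.remove[OF finE e0, of "\<lambda>e. Y (insert e0 D') e (t ` e)"]
          prod.remove[OF finE e0, of "\<lambda>e. Y D' e (t ` e)"] insert.hyps
        by (simp add: Y_def algebra_simps)
    qed
    then have "hom_poly V E n (Y (insert e0 D')) - hom_poly V E n (Y D')
        = (\<Sum>t\<in>inj_tuples V n. (x (t ` e0) - y (t ` e0)) * (\<Prod>e\<in>E - {e0}. Y D' e (t ` e)))"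
      by (simp add: hom_poly_def sum_subtractf[symmetric])
    moreover have "\<bar>\<dots>\<bar> \<le> real n ^ (card V - 2) * D"
      by (rule hom_poly_change_edge[OF V E e0 _ D]) (use x y in \<open>auto simp: Y_def\<close>)
    ultimately show ?case using insert by (simp add: algebra_simps)
  qed
  from this[of E] have "\<bar>hom_poly V E n (Y E) - hom_poly V E n (\<lambda>_. y)\<bar> \<le> real (card E) * (real n ^ (card V - 2) * D)"
    by simp
  moreover have "hom_poly V E n (Y E) = hom_poly V E n (\<lambda>_. x)"
    unfolding hom_poly_def Y_def by simp
  ultimately show ?thesis by simp
qed

section \<open>The upper bound\<close>

text \<open>AM-GM for the numbers \<open>z e ^ card E\<close>. It decouples the edges of the pattern
  and is the reason why the entropy is compared with the power \<open>card E\<close>.\<close>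

lemma prod_le_mean_power:
  fixes z :: "'i \<Rightarrow> real"
  assumes "finite E" "E \<noteq> {}" "\<And>e. e \<in> E \<Longrightarrow> z e \<ge> 0"
  shows "(\<Prod>e\<in>E. z e) \<le> (\<Sum>e\<in>E. z e ^ card E) / real (card E)"
proof -
  let ?P = "\<Prod>e\<in>E. z e"
  have d: "card E > 0" using assms by (simp add: card_gt_0_iff)
  have "?P = (?P ^ card E) powr (1 / real (card E))"
  proof (cases "?P = 0")
    case False
    then have "?P > 0" using assms(3) prod_nonneg[of E z] by fastforce
    then show ?thesis using d by (simp add: powr_realpow[symmetric] powr_powr)
  qed (use d in \<open>simp add: zero_power\<close>)
  also have "\<dots> = (\<Prod>e\<in>E. z e ^ card E) powr (1 / real (card E))"
    by (simp add: prod_power_distrib)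
  also have "\<dots> \<le> (\<Sum>e\<in>E. z e ^ card E / real (card E))"
    using assms by (intro arith_geom_mean) auto
  finally show ?thesis by (simp add: sum_divide_distrib)
qed

text \<open>The coefficient of edge \<open>f\<close> in \<open>pair_sum\<close>, equal to 0, 1 or 2.
  It rewrites a cut test as a linear form in the edge indicators, the shape that the entropy bound
  accepts.\<close>

definition orientations :: "nat set \<Rightarrow> nat set \<Rightarrow> nat set \<Rightarrow> real" where
  "orientations S T f = real (card {(i, j). i \<in> S \<and> j \<in> T \<and> i \<noteq> j \<and> {i, j} = f})"

lemma orientations_bounds:
  assumes "f \<in> nsets V 2"
  shows "0 \<le> orientations S T f" "orientations S T f \<le> 2"
proof -
  obtain a b where ab: "f = {a, b}" using assms edgeE by blast
  have "card {(i, j). i \<in> S \<and> j \<in> T \<and> i \<noteq> j \<and> {i, j} = f} \<le> card {(a, b), (b, a)}"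
  proof (rule card_mono)
    show "{(i, j). i \<in> S \<and> j \<in> T \<and> i \<noteq> j \<and> {i, j} = f} \<subseteq> {(a, b), (b, a)}"
      unfolding ab doubleton_eq_iff by blast
  qed simp
  also have "\<dots> \<le> 2" by (cases "a = b") auto
  finally show "orientations S T f \<le> 2" by (simp add: orientations_def)
qed (simp add: orientations_def)

lemma orientations_full:
  assumes "f \<in> nsets V 2"
  shows "orientations V V f = 2"
proof -
  obtain a b where ab: "f = {a, b}" "a \<in> V" "b \<in> V" "a \<noteq> b" using assms edgeE by blast
  have "{(i, j). i \<in> V \<and> j \<in> V \<and> i \<noteq> j \<and> {i, j} = f} = {(a, b), (b, a)}"
    using ab(2-4) unfolding ab(1) doubleton_eq_iff by blast
  then show ?thesis using ab by (simp add: orientations_def)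
qed

lemma pair_sum_orientations:
  assumes "finite V" "S \<subseteq> V" "T \<subseteq> V"
  shows "pair_sum B S T = (\<Sum>f\<in>nsets V 2. orientations S T f * B f)"
proof -
  let ?Z = "{(i, j). i \<in> S \<and> j \<in> T \<and> i \<noteq> j}"
  have fin: "finite S" "finite T" using assms finite_subset by auto
  have finZ: "finite ?Z" by (rule finite_subset[of _ "S \<times> T"]) (use fin in auto)
  have "pair_sum B S T = (\<Sum>(i, j)\<in>S \<times> T. if i = j then 0 else B {i, j})"
    unfolding pair_sum_def by (simp add: sum.cartesian_product)
  also have "\<dots> = (\<Sum>(i, j)\<in>?Z. B {i, j})"
    using fin by (intro sum.mono_neutral_cong_right) (auto split: if_splits)
  also have "\<dots> = (\<Sum>f\<in>nsets V 2. \<Sum>z\<in>{z \<in> ?Z. {fst z, snd z} = f}. B {fst z, snd z})"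
    unfolding split_def
    by (rule sum.group[symmetric])
      (use assms finZ in \<open>auto intro!: finite_imp_finite_nsets simp: split_def\<close>)
  also have "\<dots> = (\<Sum>f\<in>nsets V 2. orientations S T f * B f)"
  proof (rule sum.cong[OF refl])
    fix f :: "nat set"
    have "{z \<in> ?Z. {fst z, snd z} = f} = {(i, j). i \<in> S \<and> j \<in> T \<and> i \<noteq> j \<and> {i, j} = f}" by auto
    moreover have "(\<Sum>z\<in>{z \<in> ?Z. {fst z, snd z} = f}. B {fst z, snd z})
        = (\<Sum>z\<in>{z \<in> ?Z. {fst z, snd z} = f}. B f)" by (rule sum.cong) auto
    ultimately show "(\<Sum>z\<in>{z \<in> ?Z. {fst z, snd z} = f}. B {fst z, snd z}) = orientations S T f * B f"
      by (simp add: orientations_def)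
  qed
  finally show ?thesis .
qed

lemma real_choose_two: "real (n choose 2) = real n * (real n - 1) / 2"
proof -
  have "2 * (n choose 2) = n * (n - 1)"
    unfolding choose_two by (rule dvd_mult_div_cancel) (cases "even n", auto)
  then have "2 * real (n choose 2) = real n * real (n - 1)"
    by (metis of_nat_mult of_nat_numeral)
  then show ?thesis by (cases n) auto
qed

lemma card_edges: "real (card (nsets {1..n::nat} 2)) = real n * (real n - 1) / 2"
  using card_nsets[of "{1..n}" 2] by (simp add: real_choose_two)

text \<open>Each edge of the host graph is the image of \<open>e0\<close> in two orientations, with
  at most \<open>n ^ (card V - 2)\<close> placements of the other vertices.\<close>

lemma sum_edge_image_le:
  fixes g :: "nat set \<Rightarrow> real"
  assumes V: "finite V" and e0: "e0 \<in> nsets V 2" and g: "\<And>f. g f \<ge> 0"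
  shows "(\<Sum>t\<in>inj_tuples V n. g (t ` e0)) \<le> real n ^ (card V - 2) * (2 * (\<Sum>f\<in>nsets {1..n} 2. g f))"
proof -
  obtain a b where ab: "e0 = {a, b}" "a \<in> V" "b \<in> V" "a \<noteq> b"
    using e0 edgeE by metis
  let ?U = "V - {a, b}"
  let ?R = "\<lambda>s. {1..n} - s ` ?U"
  let ?G = "2 * (\<Sum>f\<in>nsets {1..n} 2. g f)"
  have G0: "0 \<le> ?G" using g by (intro mult_nonneg_nonneg sum_nonneg) auto
  have inner: "(\<Sum>i\<in>?R s. \<Sum>j\<in>?R s. if i = j then 0 else g {i, j}) \<le> ?G" for s :: "'a \<Rightarrow> nat"
  proof -
    have "(\<Sum>i\<in>?R s. \<Sum>j\<in>?R s. if i = j then 0 else g {i, j})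
        = (\<Sum>f\<in>nsets {1..n} 2. orientations (?R s) (?R s) f * g f)"
      by (subst pair_sum_orientations[of "{1..n}", symmetric]) (auto simp: pair_sum_def)
    also have "\<dots> \<le> (\<Sum>f\<in>nsets {1..n} 2. 2 * g f)"
      using g by (intro sum_mono mult_right_mono orientations_bounds) auto
    finally show ?thesis by (simp add: sum_distrib_left)
  qed
  have "(\<Sum>t\<in>inj_tuples V n. g (t ` e0))
      = (\<Sum>s\<in>inj_tuples ?U n. \<Sum>i\<in>?R s. \<Sum>j\<in>?R s. if i = j then 0 else g {i, j})"
    unfolding sum_inj_tuples_split[OF V ab(2-4)]
    using ab by (intro sum.cong refl) auto
  also have "\<dots> \<le> (\<Sum>s\<in>inj_tuples ?U n. ?G)" by (intro sum_mono inner)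
  also have "\<dots> = real (card (inj_tuples ?U n)) * ?G" by simp
  also have "\<dots> \<le> real n ^ (card V - 2) * ?G"
  proof (rule mult_right_mono[OF _ G0])
    have "card ?U = card V - 2" using V ab by (simp add: card_Diff_subset)
    then show "real (card (inj_tuples ?U n)) \<le> real n ^ (card V - 2)"
      using card_inj_tuples_le[of ?U n] V by (metis finite_Diff of_nat_le_iff of_nat_power)
  qed
  finally show ?thesis .
qed

text \<open>After AM-GM every pattern edge obeys the same bound, so the average over
  \<open>E\<close> disappears and the pattern enters only through its numbers of vertices and
  edges.\<close>

lemma hom_poly_le_power_sum:
  assumes V: "finite V" and E: "E \<subseteq> nsets V 2" "E \<noteq> {}" and y: "\<And>f. 0 \<le> y f"
  shows "hom_poly V E n (\<lambda>_. y) \<le> real n ^ (card V - 2) * (2 * (\<Sum>f\<in>nsets {1..n} 2. y f ^ card E))"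
proof -
  let ?G = "real n ^ (card V - 2) * (2 * (\<Sum>f\<in>nsets {1..n} 2. y f ^ card E))"
  have finE: "finite E"
    using V E finite_subset finite_imp_finite_nsets by blast
  have d: "real (card E) > 0" using finE E by (simp add: card_gt_0_iff)
  have "hom_poly V E n (\<lambda>_. y) \<le> (\<Sum>t\<in>inj_tuples V n. (\<Sum>e\<in>E. y (t ` e) ^ card E) / real (card E))"
    unfolding hom_poly_def using finE E y by (intro sum_mono prod_le_mean_power) auto
  also have "\<dots> = (\<Sum>e\<in>E. \<Sum>t\<in>inj_tuples V n. y (t ` e) ^ card E) / real (card E)"
    by (simp add: sum_divide_distrib[symmetric] sum.swap[of _ E])
  also have "\<dots> \<le> (\<Sum>e\<in>E. ?G) / real (card E)"
    using V E y by (intro divide_right_mono sum_mono sum_edge_image_le) auto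
  also have "\<dots> = ?G" using d by simp
  finally show ?thesis .
qed

section \<open>Exponential tests for the cut norm\<close>

definition cut_tests :: "nat \<Rightarrow> (real \<times> nat set \<times> nat set) set" where
  "cut_tests n = {1, -1} \<times> Pow {1..n} \<times> Pow {1..n}"

text \<open>The factor \<open>1 / sqrt n\<close> makes the sum of squared weights over about
  \<open>n ^ 2 / 2\<close> edges linear in \<open>n\<close>, like the logarithm of the number of
  tests.\<close>

definition test_weight :: "nat \<Rightarrow> real \<times> nat set \<times> nat set \<Rightarrow> nat set \<Rightarrow> real" where
  "test_weight n k f = fst k * orientations (fst (snd k)) (snd (snd k)) f / sqrt (real n)"

text \<open>A smooth upper bound for the cut norm: \<open>exp\<close> exceeds its tangent at \<open>4 * n\<close>, and the
  maximum over the \<open>2 * 4 ^ n\<close> tests is bounded by a sum.\<close>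
definition soft_cut :: "nat \<Rightarrow> (nat set \<Rightarrow> real) \<Rightarrow> real" where
  "soft_cut n B = sqrt (real n) * (4 * real n - 1 +
     (\<Sum>k\<in>cut_tests n. exp (- (4 * real n)) * exp (\<Sum>f\<in>nsets {1..n} 2. test_weight n k f * B f)))"

lemma finite_cut_tests [simp]: "finite (cut_tests n)"
  by (simp add: cut_tests_def)

lemma pair_sum_le_soft_cut:
  assumes n: "n > 0" and S: "S \<subseteq> {1..n}" "T \<subseteq> {1..n}"
  shows "\<bar>pair_sum B S T\<bar> \<le> soft_cut n B"
proof -
  define z where "z = pair_sum B S T"
  define \<sigma> :: real where "\<sigma> = (if z \<ge> 0 then 1 else -1)"
  have k: "(\<sigma>, S, T) \<in> cut_tests n" using S by (simp add: cut_tests_def \<sigma>_def)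
  have sq: "sqrt (real n) > 0" using n by simp
  have e: "(\<Sum>f\<in>nsets {1..n} 2. test_weight n (\<sigma>, S, T) f * B f) = \<bar>z\<bar> / sqrt (real n)"
  proof -
    have "(\<Sum>f\<in>nsets {1..n} 2. test_weight n (\<sigma>, S, T) f * B f)
        = \<sigma> * z / sqrt (real n)"
      unfolding z_def pair_sum_orientations[OF _ S, simplified]
      by (simp add: test_weight_def sum_distrib_left sum_divide_distrib mult_ac)
    then show ?thesis by (simp add: \<sigma>_def)
  qed
  have "\<bar>z\<bar> / sqrt (real n) \<le> 4 * real n - 1 + exp (- (4 * real n)) * exp (\<bar>z\<bar> / sqrt (real n))"
    using exp_ge_add_one_self[of "\<bar>z\<bar> / sqrt (real n) - 4 * real n"]
    by (simp add: exp_diff exp_minus field_simps)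
  also have "exp (- (4 * real n)) * exp (\<bar>z\<bar> / sqrt (real n))
      \<le> (\<Sum>k\<in>cut_tests n. exp (- (4 * real n)) * exp (\<Sum>f\<in>nsets {1..n} 2. test_weight n k f * B f))"
    unfolding e[symmetric] by (rule member_le_sum[OF k]) auto
  finally have "\<bar>z\<bar> / sqrt (real n) * sqrt (real n) \<le> soft_cut n B"
    unfolding soft_cut_def using sq by (subst mult.commute[of "sqrt _"]) (intro mult_right_mono, auto)
  then show ?thesis using sq by (simp add: z_def)
qed

text \<open>Origin of the 4 in \<open>soft_cut\<close>: squared weights are at most
  \<open>4 / n\<close>, so each exponent is at most \<open>n / 4\<close>, and there are
  \<open>2 * 4 ^ n \<le> exp (3 * n)\<close> tests. Since 3 + 1/4 < 4, the factor
  \<open>exp (- (4 * n))\<close> wins.\<close>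

lemma cut_tests_exp_sum:
  assumes n: "n > 0"
  shows "(\<Sum>k\<in>cut_tests n. exp (- (4 * real n)) * exp (\<Sum>f\<in>nsets {1..n} 2. (test_weight n k f)\<^sup>2 / 8)) \<le> 1"
proof -
  have w: "(\<Sum>f\<in>nsets {1..n} 2. (test_weight n k f)\<^sup>2 / 8) \<le> real n / 4" if "k \<in> cut_tests n" for k
  proof -
    have "(\<Sum>f\<in>nsets {1..n} 2. (test_weight n k f)\<^sup>2 / 8) \<le> (\<Sum>f\<in>nsets {1..n} 2. 1 / (2 * real n))"
    proof (rule sum_mono)
      fix f :: "nat set" assume f: "f \<in> nsets {1..n} 2"
      have "(fst k)\<^sup>2 = 1" using that by (auto simp: cut_tests_def)
      then have "(test_weight n k f)\<^sup>2 = (orientations (fst (snd k)) (snd (snd k)) f)\<^sup>2 / real n"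
        using n by (simp add: test_weight_def power_mult_distrib power_divide)
      also have "\<dots> \<le> 2\<^sup>2 / real n"
        using orientations_bounds[OF f] by (intro divide_right_mono power_mono) auto
      finally show "(test_weight n k f)\<^sup>2 / 8 \<le> 1 / (2 * real n)" by simp
    qed
    also have "\<dots> = (real n - 1) / 4" using n by (simp add: real_choose_two field_simps)
    finally show ?thesis by simp
  qed
  have "(\<Sum>k\<in>cut_tests n. exp (- (4 * real n)) * exp (\<Sum>f\<in>nsets {1..n} 2. (test_weight n k f)\<^sup>2 / 8))
      \<le> (\<Sum>k\<in>cut_tests n. exp (- (4 * real n)) * exp (real n / 4))"
    by (intro sum_mono mult_left_mono) (simp_all only: exp_le_cancel_iff exp_ge_zero w)
  also have "\<dots> = real (card (cut_tests n)) * exp (- (15 / 4 * real n))"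
    by (simp add: exp_add[symmetric])
  also have "real (card (cut_tests n)) \<le> exp (3 * real n)"
  proof -
    have "real (card (cut_tests n)) = 2 * 4 ^ n"
      by (simp add: cut_tests_def card_cartesian_product card_Pow power_mult_distrib[symmetric])
    also have "\<dots> \<le> 2 ^ n * 4 ^ n"
      using n by (intro mult_right_mono) (auto simp: self_le_power)
    also have "\<dots> = (2 ^ 3) ^ n" by (simp add: power_mult_distrib[symmetric])
    also have "\<dots> \<le> (exp 1 ^ 3) ^ n"
      using exp_ge_add_one_self[of 1] by (intro power_mono) auto
    also have "\<dots> = exp (3 * real n)" by (simp add: exp_of_nat_mult[symmetric] mult_ac flip: power_mult)
    finally show ?thesis .
  qed
  then have "real (card (cut_tests n)) * exp (- (15 / 4 * real n)) \<le> exp (3 * real n) * exp (- (15 / 4 * real n))"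
    by (rule mult_right_mono) simp
  also have "\<dots> \<le> 1" by (simp add: exp_add[symmetric])
  finally show ?thesis .
qed

text \<open>On the event, \<open>M\<close> is at most the polynomial at \<open>q\<close> plus a
  multiple of \<open>soft_cut\<close>, and the polynomial at \<open>q\<close> is at most a power
  sum. Multiplying by \<open>c\<close> and adding the supporting line over all edges turns the power
  sum into entropy, which is the pointwise hypothesis of the entropy bound.\<close>

lemma ln_prob_hom_poly_tail_le:
  assumes V: "finite V" and E: "E \<subseteq> nsets V 2" "E \<noteq> {}" and p: "0 < p" "p < 1" and n: "n > 0"
    and c: "c \<ge> 0"
    and supp: "\<And>y. 0 \<le> y \<Longrightarrow> y \<le> 1 \<Longrightarrow> rel_entropy r p + c * (y ^ card E - r ^ card E) \<le> rel_entropy y p"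
    and pos: "measure_pmf.prob (Pi_pmf (nsets {1..n} 2) False (\<lambda>_. bernoulli_pmf p))
        {x. M \<le> hom_poly V E n (\<lambda>_ f. of_bool (x f))} > 0"
  shows "ln (measure_pmf.prob (Pi_pmf (nsets {1..n} 2) False (\<lambda>_. bernoulli_pmf p))
        {x. M \<le> hom_poly V E n (\<lambda>_ f. of_bool (x f))})
    \<le> - (real n * (real n - 1) / 2 * (rel_entropy r p - c * r ^ card E)
         + c * (M / (2 * real n ^ (card V - 2)) - 2 * real (card E) * real n * sqrt (real n)))"
proof -
  let ?S = "nsets {1..n} 2"
  let ?m = "real n * (real n - 1) / 2"
  let ?N = "real n ^ (card V - 2)"
  let ?d = "real (card E)"
  have finS: "finite ?S" by (simp add: finite_imp_finite_nsets)
  have N0: "?N > 0" using n by simp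
  \<comment> \<open>The common coefficient of the exponentials in the \<open>soft_cut\<close> error,
    after multiplication by \<open>c\<close> and division by \<open>2 * n ^ (card V - 2)\<close>.
    The constant part of \<open>soft_cut\<close> goes into \<open>b\<close>.\<close>
  define u where "u = c * (?d / 2) * sqrt (real n) * exp (- (4 * real n))"
  have u0: "u \<ge> 0" using c by (simp add: u_def)
  define b where "b = ?m * (rel_entropy r p - c * r ^ card E) + c * (M / (2 * ?N))
      - c * (?d / 2) * sqrt (real n) * (4 * real n - 1)"
  have "b \<le> - ln (measure_pmf.prob (Pi_pmf ?S False (\<lambda>_. bernoulli_pmf p))
         {x. M \<le> hom_poly V E n (\<lambda>_ f. of_bool (x f))})
      + (\<Sum>k\<in>cut_tests n. u * exp (\<Sum>f\<in>?S. (test_weight n k f)\<^sup>2 / 8))"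
  proof (rule conditioned_product_entropy_bound[OF finS p finite_cut_tests u0 pos])
    fix x :: "nat set \<Rightarrow> bool" and q :: "nat set \<Rightarrow> real"
    assume "x \<in> {x. M \<le> hom_poly V E n (\<lambda>_ f. of_bool (x f))}" and q: "\<And>e. 0 \<le> q e \<and> q e \<le> 1"
    then have x: "M \<le> hom_poly V E n (\<lambda>_ f. of_bool (x f))" by simp
    let ?D = "soft_cut n (\<lambda>f. of_bool (x f) - q f)"
    have "\<bar>hom_poly V E n (\<lambda>_ f. of_bool (x f)) - hom_poly V E n (\<lambda>_. q)\<bar> \<le> ?d * (?N * ?D)"
      using q by (intro hom_poly_cut_continuity[OF V E(1)] pair_sum_le_soft_cut[OF n]) auto
    then have "M \<le> ?N * (2 * (\<Sum>f\<in>?S. q f ^ card E)) + ?d * (?N * ?D)"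
      using x hom_poly_le_power_sum[OF V E, of q n] q by (auto simp: abs_le_iff)
    then have "M / (2 * ?N) \<le> (\<Sum>f\<in>?S. q f ^ card E) + ?d / 2 * ?D"
      using N0 by (simp add: field_simps)
    then have "c * (M / (2 * ?N)) \<le> c * ((\<Sum>f\<in>?S. q f ^ card E) + ?d / 2 * ?D)"
      using c by (rule mult_left_mono)
    moreover have "?m * (rel_entropy r p - c * r ^ card E) + c * (\<Sum>f\<in>?S. q f ^ card E)
        \<le> (\<Sum>f\<in>?S. rel_entropy (q f) p)"
    proof -
      have "?m * (rel_entropy r p - c * r ^ card E) + c * (\<Sum>f\<in>?S. q f ^ card E)
         = (\<Sum>f\<in>?S. (rel_entropy r p - c * r ^ card E) + c * q f ^ card E)"
        by (simp only: sum.distrib sum_constant sum_distrib_left card_edges)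
      also have "\<dots> = (\<Sum>f\<in>?S. rel_entropy r p + c * (q f ^ card E - r ^ card E))"
        by (intro sum.cong) (simp_all add: algebra_simps)
      also have "\<dots> \<le> (\<Sum>f\<in>?S. rel_entropy (q f) p)"
        using q by (intro sum_mono supp) auto
      finally show ?thesis .
    qed
    moreover have "c * (?d / 2 * ?D) = c * (?d / 2) * sqrt (real n) * (4 * real n - 1)
        + (\<Sum>k\<in>cut_tests n. u * exp (\<Sum>f\<in>?S. test_weight n k f * (of_bool (x f) - q f)))"
      unfolding soft_cut_def u_def by (simp only: sum_distrib_left distrib_left mult_ac)
    ultimately show "b \<le> (\<Sum>e\<in>?S. rel_entropy (q e) p)
        + (\<Sum>k\<in>cut_tests n. u * exp (\<Sum>e\<in>?S. test_weight n k e * (of_bool (x e) - q e)))"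
      unfolding b_def distrib_left by linarith
  qed
  also have "(\<Sum>k\<in>cut_tests n. u * exp (\<Sum>f\<in>?S. (test_weight n k f)\<^sup>2 / 8))
      = c * (?d / 2) * sqrt (real n) * (\<Sum>k\<in>cut_tests n. exp (- (4 * real n)) * exp (\<Sum>f\<in>?S. (test_weight n k f)\<^sup>2 / 8))"
    unfolding u_def by (simp add: sum_distrib_left mult_ac)
  also have "\<dots> \<le> c * (?d / 2) * sqrt (real n) * 1"
    using c by (intro mult_left_mono cut_tests_exp_sum[OF n]) auto
  finally have "b \<le> - ln (measure_pmf.prob (Pi_pmf ?S False (\<lambda>_. bernoulli_pmf p))
         {x. M \<le> hom_poly V E n (\<lambda>_ f. of_bool (x f))}) + c * (?d / 2) * sqrt (real n)" by simp
  \<comment> \<open>The exponentials cost one more unit beside \<open>4 * n - 1\<close>, which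
    rounds the error to \<open>2 * card E * n * sqrt n\<close>.\<close>
  moreover have "b = ?m * (rel_entropy r p - c * r ^ card E)
      + c * (M / (2 * ?N) - 2 * ?d * real n * sqrt (real n)) + c * (?d / 2) * sqrt (real n)"
    unfolding b_def by (simp add: algebra_simps diff_divide_distrib)
  ultimately show ?thesis by linarith
qed

section \<open>The lower bound\<close>

abbreviation edge_pmf :: "nat \<Rightarrow> real \<Rightarrow> (nat set \<Rightarrow> bool) pmf" where
  "edge_pmf n p \<equiv> Pi_pmf (nsets {1..n} 2) False (\<lambda>_. bernoulli_pmf p)"

lemma finite_edges [simp]: "finite (nsets {m..n::nat} 2)"
  by (simp add: finite_imp_finite_nsets)

lemma finite_set_bernoulli_product:
  assumes "finite S"
  shows "finite (set_pmf (Pi_pmf S False (\<lambda>_. bernoulli_pmf p)))"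
  by (rule finite_subset[OF set_Pi_pmf_subset'[OF assms]], rule finite_PiE_dflt[OF assms]) simp

text \<open>For the unconditioned product measure the centring is the constant \<open>s\<close>, and
  independence factorises the exponential moments; the two-point bound then gives the same estimate
  as in the martingale case.\<close>

lemma expectation_soft_cut_le:
  assumes n: "n > 0" and s: "0 < s" "s < 1"
  shows "measure_pmf.expectation (edge_pmf n s) (\<lambda>x. soft_cut n (\<lambda>f. of_bool (x f) - s))
    \<le> 4 * real n * sqrt (real n)"
proof -
  let ?S = "nsets {1..n} 2"
  have int: "integrable (measure_pmf (edge_pmf n s)) g" for g :: "(nat set \<Rightarrow> bool) \<Rightarrow> real"
    by (intro integrable_measure_pmf_finite finite_set_bernoulli_product) simp
  have E: "measure_pmf.expectation (edge_pmf n s) (\<lambda>x. exp (\<Sum>f\<in>?S. test_weight n k f * (of_bool (x f) - s)))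
      \<le> exp (\<Sum>f\<in>?S. (test_weight n k f)\<^sup>2 / 8)" for k
  proof -
    have "measure_pmf.expectation (edge_pmf n s) (\<lambda>x. exp (\<Sum>f\<in>?S. test_weight n k f * (of_bool (x f) - s)))
        = measure_pmf.expectation (edge_pmf n s) (\<lambda>x. \<Prod>f\<in>?S. exp (test_weight n k f * (of_bool (x f) - s)))"
      by (simp only: exp_sum finite_edges)
    also have "\<dots> = (\<Prod>f\<in>?S. measure_pmf.expectation (bernoulli_pmf s) (\<lambda>y. exp (test_weight n k f * (of_bool y - s))))"
      by (rule expectation_prod_Pi_pmf[where f = "\<lambda>f y. exp (test_weight n k f * (of_bool y - s))"])
        (auto intro!: integrable_measure_pmf_finite)
    also have "\<dots> \<le> (\<Prod>f\<in>?S. exp ((test_weight n k f)\<^sup>2 / 8))"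
    proof (intro prod_mono conjI)
      fix f
      show "0 \<le> measure_pmf.expectation (bernoulli_pmf s) (\<lambda>y. exp (test_weight n k f * (of_bool y - s)))"
        by simp
      show "measure_pmf.expectation (bernoulli_pmf s) (\<lambda>y. exp (test_weight n k f * (of_bool y - s)))
          \<le> exp ((test_weight n k f)\<^sup>2 / 8)"
        using two_point_exp_bound[of s "test_weight n k f"] s by (simp add: mult_ac)
    qed
    also have "\<dots> = exp (\<Sum>f\<in>?S. (test_weight n k f)\<^sup>2 / 8)" by (simp only: exp_sum finite_edges)
    finally show ?thesis .
  qed
  have "measure_pmf.expectation (edge_pmf n s) (\<lambda>x. soft_cut n (\<lambda>f. of_bool (x f) - s))
      = sqrt (real n) * (4 * real n - 1 + (\<Sum>k\<in>cut_tests n. exp (- (4 * real n)) *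
          measure_pmf.expectation (edge_pmf n s) (\<lambda>x. exp (\<Sum>f\<in>?S. test_weight n k f * (of_bool (x f) - s)))))"
    unfolding soft_cut_def using int by (simp add: Bochner_Integration.integral_sum)
  also have "\<dots> \<le> sqrt (real n) * (4 * real n - 1 + (\<Sum>k\<in>cut_tests n. exp (- (4 * real n)) *
       exp (\<Sum>f\<in>?S. (test_weight n k f)\<^sup>2 / 8)))"
    by (intro mult_left_mono add_left_mono sum_mono E) auto
  also have "\<dots> \<le> sqrt (real n) * (4 * real n - 1 + 1)"
    by (intro mult_left_mono add_left_mono cut_tests_exp_sum n) auto
  finally show ?thesis by (simp add: mult_ac)
qed

text \<open>Markov's inequality at twice the mean. Probability one half suffices, since a constant
  factor is negligible on the exponential scale.\<close>

lemma prob_soft_cut_le: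
  assumes n: "n > 0" and s: "0 < s" "s < 1"
  shows "measure_pmf.prob (edge_pmf n s) {x. soft_cut n (\<lambda>f. of_bool (x f) - s) \<le> 8 * real n * sqrt (real n)} \<ge> 1 / 2"
proof -
  let ?c = "8 * real n * sqrt (real n)"
  let ?u = "\<lambda>x. soft_cut n (\<lambda>f. of_bool (x f) - s)"
  have c: "?c > 0" using n by simp
  have u0: "soft_cut n B \<ge> 0" for B
    unfolding soft_cut_def using n by (intro mult_nonneg_nonneg add_nonneg_nonneg sum_nonneg) auto
  have "measure_pmf.prob (edge_pmf n s) {x \<in> space (measure_pmf (edge_pmf n s)). ?u x \<ge> ?c}
      \<le> measure_pmf.expectation (edge_pmf n s) ?u / ?c"
    by (rule integral_Markov_inequality_measure[where A = "{}"])
      (use c u0 in \<open>auto intro!: integrable_measure_pmf_finite finite_set_bernoulli_product\<close>)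
  also have "\<dots> \<le> (4 * real n * sqrt (real n)) / ?c"
    using c expectation_soft_cut_le[OF n s] by (intro divide_right_mono) auto
  also have "\<dots> = 1 / 2" using n by simp
  finally have "measure_pmf.prob (edge_pmf n s) {x. ?u x \<ge> ?c} \<le> 1 / 2" by simp
  moreover have "1 - measure_pmf.prob (edge_pmf n s) {x. ?u x \<ge> ?c} = measure_pmf.prob (edge_pmf n s) (- {x. ?u x \<ge> ?c})"
    using measure_pmf.prob_compl[of "{x. ?u x \<ge> ?c}" "edge_pmf n s"] by (simp add: Compl_eq_Diff_UNIV)
  moreover have "\<dots> \<le> measure_pmf.prob (edge_pmf n s) {x. ?u x \<le> ?c}"
    by (intro measure_pmf.finite_measure_mono) auto
  ultimately show ?thesis by linarith
qed

text \<open>\<open>L\<close> bounds the log likelihood ratio on \<open>A\<close>, so each atom loses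
  at most the factor \<open>exp (- L)\<close>.\<close>

lemma bernoulli_product_change_of_measure:
  assumes S: "finite S" and p: "0 < p" "p < 1" and s: "0 < s" "s < 1"
    and L: "\<And>x. x \<in> A \<Longrightarrow> (\<Sum>f\<in>S. if x f then ln s - ln p else ln (1 - s) - ln (1 - p)) \<le> L"
  shows "measure_pmf.prob (Pi_pmf S False (\<lambda>_. bernoulli_pmf s)) A * exp (- L)
    \<le> measure_pmf.prob (Pi_pmf S False (\<lambda>_. bernoulli_pmf p)) A"
proof -
  let ?P = "\<lambda>p. Pi_pmf S False (\<lambda>_. bernoulli_pmf p)"
  \<comment> \<open>The common support of both laws, as neither parameter is 0 or 1; it is finite,
    so the comparison is made atom by atom.\<close>
  define F where "F = PiE_dflt S False (\<lambda>_. UNIV :: bool set)"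
  have finF: "finite F" unfolding F_def using S by (intro finite_PiE_dflt) auto
  have F: "set_pmf (?P t) = F" if "0 < t" "t < 1" for t
    unfolding F_def using S that by (subst set_Pi_pmf) (auto simp: comp_def)
  have prob: "measure_pmf.prob (?P t) A = (\<Sum>x\<in>A \<inter> F. pmf (?P t) x)" if "0 < t" "t < 1" for t
    using measure_Int_set_pmf[of "?P t" A] finF
    unfolding F[OF that] by (subst (asm) measure_measure_pmf_finite) auto
  have pmf: "pmf (?P t) x = exp (\<Sum>f\<in>S. if x f then ln t else ln (1 - t))" if t: "0 < t" "t < 1" and x: "x \<in> F" for t x
  proof -
    have "pmf (?P t) x = (\<Prod>f\<in>S. pmf (bernoulli_pmf t) (x f))"
      using x S by (intro pmf_Pi') (auto simp: F_def PiE_dflt_def)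
    also have "\<dots> = (\<Prod>f\<in>S. exp (if x f then ln t else ln (1 - t)))"
      using t by (intro prod.cong) auto
    finally show ?thesis using S by (simp add: exp_sum)
  qed
  have "(\<Sum>x\<in>A \<inter> F. pmf (?P s) x) * exp (- L) = (\<Sum>x\<in>A \<inter> F. pmf (?P s) x * exp (- L))"
    by (simp add: sum_distrib_right)
  also have "\<dots> \<le> (\<Sum>x\<in>A \<inter> F. pmf (?P p) x)"
  proof (rule sum_mono)
    fix x assume x: "x \<in> A \<inter> F"
    have "(\<Sum>f\<in>S. if x f then ln s - ln p else ln (1 - s) - ln (1 - p))
        = (\<Sum>f\<in>S. if x f then ln s else ln (1 - s)) - (\<Sum>f\<in>S. if x f then ln p else ln (1 - p))"
      unfolding sum_subtractf[symmetric] by (intro sum.cong) auto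
    then have "(\<Sum>f\<in>S. if x f then ln s else ln (1 - s)) - L \<le> (\<Sum>f\<in>S. if x f then ln p else ln (1 - p))"
      using L[of x] x by simp
    then show "pmf (?P s) x * exp (- L) \<le> pmf (?P p) x"
      using x p s by (simp add: pmf exp_add[symmetric])
  qed
  finally show ?thesis using prob p s by simp
qed

text \<open>The falling factorial against the full power; the extra factor \<open>n\<close> on both
  sides avoids a truncated exponent \<open>card V - 1\<close>.\<close>

lemma card_inj_tuples_ge:
  assumes "finite V"
  shows "real n * real (card (inj_tuples V n)) \<ge> real n ^ (card V + 1) - (real (card V))\<^sup>2 * real n ^ card V"
  using assms
proof (induction V rule: finite_induct)
  case (insert a V)
  let ?k = "card V"
  have "card (inj_tuples (insert a V) n) = prod ((-) n) {0..<Suc ?k}"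
    unfolding inj_tuples_def using card_inj_on_subset_funcset[of "insert a V" "{1..n}" "insert a V"] insert.hyps by simp
  moreover have "card (inj_tuples V n) = prod ((-) n) {0..<?k}"
    unfolding inj_tuples_def using card_inj_on_subset_funcset[of V "{1..n}" V] insert.hyps by simp
  ultimately have c: "card (inj_tuples (insert a V) n) = (n - ?k) * card (inj_tuples V n)"
    by (simp add: mult.commute)
  let ?P = "real (card (inj_tuples V n))"
  have P: "?P \<le> real n ^ ?k"
    using card_inj_tuples_le[of V n] insert.hyps by (metis of_nat_le_iff of_nat_power)
  have "real (n - ?k) * ?P \<ge> (real n - real ?k) * ?P"
    by (intro mult_right_mono) auto
  then have "real (card (inj_tuples (insert a V) n)) \<ge> real n * ?P - real ?k * ?P"
    by (simp only: c of_nat_mult left_diff_distrib)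
  moreover have "real ?k * ?P \<le> real ?k * real n ^ ?k" using P by (rule mult_left_mono) simp
  ultimately have "real (card (inj_tuples (insert a V) n)) \<ge> real n * ?P - real ?k * real n ^ ?k" by linarith
  then have "real (card (inj_tuples (insert a V) n)) \<ge> real n ^ (?k + 1) - (real ?k)\<^sup>2 * real n ^ ?k - real ?k * real n ^ ?k"
    using insert.IH by linarith
  then have "real n * real (card (inj_tuples (insert a V) n))
      \<ge> real n * (real n ^ (?k + 1) - (real ?k)\<^sup>2 * real n ^ ?k - real ?k * real n ^ ?k)"
    by (rule mult_left_mono) simp
  moreover have "real n * (real n ^ (?k + 1) - (real ?k)\<^sup>2 * real n ^ ?k - real ?k * real n ^ ?k)
      = real n ^ (Suc ?k + 1) - ((real ?k)\<^sup>2 + real ?k) * real n ^ Suc ?k"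
    by (simp add: algebra_simps)
  moreover have "((real ?k)\<^sup>2 + real ?k) * real n ^ Suc ?k \<le> (real (Suc ?k))\<^sup>2 * real n ^ Suc ?k"
    by (intro mult_right_mono) (auto simp: power2_eq_square algebra_simps)
  ultimately show ?case using insert.hyps by simp
qed (simp add: inj_tuples_def PiE_empty_domain)

lemma hom_poly_const: "finite E \<Longrightarrow> hom_poly V E n (\<lambda>_ _. s) = real (card (inj_tuples V n)) * s ^ card E"
  by (simp add: hom_poly_def)

text \<open>The measure is tilted to density \<open>s = r + K / sqrt n\<close>. The excess over
  \<open>r\<close> outweighs the cut-norm fluctuation, so on the event of small
  \<open>soft_cut\<close> the count lies above its target but within
  \<open>O(n ^ card V / sqrt n)\<close> of it. The same event bounds the likelihood ratio.\<close>

lemma prob_hom_poly_window_ge: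
  assumes V: "finite V" and E: "E \<subseteq> nsets V 2" "E \<noteq> {}" and p: "0 < p" "p < 1" and r: "p < r" "r < 1"
  shows "\<exists>K C. \<forall>\<^sub>F n in sequentially.
    exp (- (real n ^ 2 / 2 * rel_entropy r p + K * real n * sqrt (real n))) \<le>
    measure_pmf.prob (edge_pmf n p)
      {x. real (card (inj_tuples V n)) * r ^ card E \<le> hom_poly V E n (\<lambda>_ f. of_bool (x f)) \<and>
          hom_poly V E n (\<lambda>_ f. of_bool (x f))
            \<le> real (card (inj_tuples V n)) * r ^ card E + C * (real n ^ card V / sqrt (real n))}"
proof -
  have finE: "finite E"
    using V E finite_subset finite_imp_finite_nsets by blast
  let ?d = "card E"
  have d: "?d > 0" using finE E by (simp add: card_gt_0_iff)
  have cV: "card V \<ge> 2"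
  proof -
    obtain e where "e \<in> nsets V 2" using E by auto
    then show ?thesis using V by (auto simp: nsets_def dest: card_mono)
  qed
  \<comment> \<open>A fixed barrier between \<open>r\<close> and 1: once
    \<open>s \<le> \<rho>\<close>, the log odds of \<open>s\<close> are bounded uniformly in
    \<open>n\<close>.\<close>
  define \<rho> where "\<rho> = (1 + r) / 2"
  have \<rho>: "r < \<rho>" "\<rho> < 1" using r by (auto simp: \<rho>_def)
  define \<Lambda> where "\<Lambda> = log_odds \<rho> - log_odds p"
  have \<Lambda>: "\<Lambda> \<ge> 0" using log_odds_mono[of p \<rho>] p r \<rho> by (simp add: \<Lambda>_def)
  \<comment> \<open>Chosen so that \<open>n ^ card V / 2\<close> tuples, each gaining
    \<open>r ^ (card E - 1) * K / sqrt n\<close>, exactly offset the cut-norm error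
    \<open>8 * card E * n ^ card V / sqrt n\<close>.\<close>
  define K where "K = 16 * real ?d / r ^ (?d - 1)"
  have K: "K > 0" using p r d by (simp add: K_def)
  define C where "C = real ?d * K + 8 * real ?d"
  \<comment> \<open>The three terms pay for the entropy increase from \<open>r\<close> to
    \<open>s\<close>, the fluctuation of the edge count, and the probability one half of the good
    event.\<close>
  define K' where "K' = K * \<Lambda> / 2 + 4 * \<Lambda> + ln 2"
  \<comment> \<open>The second threshold makes at least half of all tuples injective; the third
    gives \<open>s \<le> \<rho>\<close>.\<close>
  have ev1: "\<forall>\<^sub>F n in sequentially. real n \<ge> max 1 (max (2 * (real (card V))\<^sup>2) ((K / (\<rho> - r))\<^sup>2))"
    using filterlim_real_sequentially unfolding filterlim_at_top by blast
  show ?thesis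
  proof (rule exI[of _ K'], rule exI[of _ C], rule eventually_mono[OF ev1])
    fix n assume "real n \<ge> max 1 (max (2 * (real (card V))\<^sup>2) ((K / (\<rho> - r))\<^sup>2))"
    then have n1: "real n \<ge> 1" and n2: "2 * (real (card V))\<^sup>2 \<le> real n" and n3: "(K / (\<rho> - r))\<^sup>2 \<le> real n" by auto
    then have n: "n > 0" by simp
    let ?q = "sqrt (real n)"
    have q1: "?q \<ge> 1" using n1 by simp
    have qq: "?q * ?q = real n" by simp
    define s where "s = r + K / ?q"
    have s: "r < s" "s \<le> \<rho>"
    proof -
      show "r < s" using K q1 by (simp add: s_def)
      have "K / (\<rho> - r) \<le> ?q" using n3 by (rule real_le_rsqrt)
      then show "s \<le> \<rho>" using \<rho> q1 by (simp add: s_def field_simps)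
    qed
    let ?J = "real (card (inj_tuples V n))"
    have J1: "?J \<le> real n ^ card V"
      using card_inj_tuples_le[OF V, of n] by (metis of_nat_le_iff of_nat_power)
    have J2: "?J \<ge> real n ^ card V / 2"
    proof -
      have "(real (card V))\<^sup>2 * real n ^ card V \<le> real n / 2 * real n ^ card V"
        using n2 by (intro mult_right_mono) auto
      then have "real n * ?J \<ge> real n * (real n ^ card V / 2)"
        using card_inj_tuples_ge[OF V, of n] by simp
      then show ?thesis using n by (simp only: mult_le_cancel_left_pos of_nat_0_less_iff)
    qed
    let ?G = "{x. soft_cut n (\<lambda>f. of_bool (x f) - s) \<le> 8 * real n * ?q}"
    let ?A = "{x. ?J * r ^ ?d \<le> hom_poly V E n (\<lambda>_ f. of_bool (x f)) \<and>
          hom_poly V E n (\<lambda>_ f. of_bool (x f)) \<le> ?J * r ^ ?d + C * (real n ^ card V / ?q)}"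
    have s01: "0 < s" "s < 1" using s \<rho> p r by auto
    have pd1: "s ^ ?d - r ^ ?d \<ge> r ^ (?d - 1) * (K / ?q)"
    proof -
      have "s ^ ?d = s * s ^ (?d - 1)" "r ^ ?d = r * r ^ (?d - 1)" using d by (metis power_eq_if not_gr0)+
      moreover have "s * s ^ (?d - 1) \<ge> s * r ^ (?d - 1)"
        using s s01 p r by (intro mult_left_mono power_mono) auto
      ultimately show ?thesis by (simp add: s_def algebra_simps)
    qed
    have pd2: "s ^ ?d - r ^ ?d \<le> real ?d * (K / ?q)"
      using norm_power_diff[of s r ?d] s s01 p r K q1 by (simp add: s_def)
    have GA: "x \<in> ?A" if x: "x \<in> ?G" for x
    proof -
      have "\<bar>hom_poly V E n (\<lambda>_ f. of_bool (x f)) - hom_poly V E n (\<lambda>_ _. s)\<bar>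
          \<le> real ?d * (real n ^ (card V - 2) * (8 * real n * ?q))"
      proof (rule hom_poly_cut_continuity[OF V E(1)])
        fix S T assume "S \<subseteq> {1..n}" "T \<subseteq> {1..n}"
        then show "\<bar>pair_sum (\<lambda>f. of_bool (x f) - s) S T\<bar> \<le> 8 * real n * ?q"
          using pair_sum_le_soft_cut[OF n, of S T "\<lambda>f. of_bool (x f) - s"] x by simp
      qed (use s01 in auto)
      also have "real ?d * (real n ^ (card V - 2) * (8 * real n * ?q)) = 8 * real ?d * (real n ^ card V / ?q)"
      proof -
        have "real n ^ card V = real n ^ (card V - 2) * real n ^ 2"
          using cV by (simp only: power_add[symmetric] le_add_diff_inverse2)
        then have "real n ^ card V / ?q = real n ^ (card V - 2) * (real n * (real n / ?q))"
          by (simp only: power2_eq_square times_divide_eq_right)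
        then show ?thesis by (simp add: real_div_sqrt mult_ac)
      qed
      finally have h: "\<bar>hom_poly V E n (\<lambda>_ f. of_bool (x f)) - ?J * s ^ ?d\<bar> \<le> 8 * real ?d * (real n ^ card V / ?q)"
        using finE by (simp add: hom_poly_const)
      have "?J * (s ^ ?d - r ^ ?d) \<ge> (real n ^ card V / 2) * (r ^ (?d - 1) * (K / ?q))"
        using J2 pd1 K q1 p r by (intro mult_mono) auto
      moreover have "(real n ^ card V / 2) * (r ^ (?d - 1) * (K / ?q)) = 8 * real ?d * (real n ^ card V / ?q)"
        using p r by (simp add: K_def)
      moreover have "?J * (s ^ ?d - r ^ ?d) \<le> real n ^ card V * (real ?d * (K / ?q))"
        using J1 pd2 s p r by (intro mult_mono) (auto intro!: power_mono)
      moreover have "real n ^ card V * (real ?d * (K / ?q)) + 8 * real ?d * (real n ^ card V / ?q) = C * (real n ^ card V / ?q)"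
        by (simp add: C_def algebra_simps)
      ultimately show ?thesis using h by (auto simp: abs_le_iff right_diff_distrib)
    qed
    define L where "L = real n ^ 2 / 2 * rel_entropy r p + (K * \<Lambda> / 2 + 4 * \<Lambda>) * real n * ?q"
    have slope: "log_odds s - log_odds p \<le> \<Lambda>" "log_odds s - log_odds p \<ge> 0"
      using log_odds_mono[of s \<rho>] log_odds_mono[of p s] s s01 p r \<rho> by (auto simp: \<Lambda>_def)
    have Is: "rel_entropy s p \<le> rel_entropy r p + K * \<Lambda> / ?q"
    proof -
      obtain z where z: "r < z" "z < s" "rel_entropy s p - rel_entropy r p = (s - r) * (log_odds z - log_odds p)"
        using MVT2[OF s(1), of "\<lambda>r. rel_entropy r p" "\<lambda>z. log_odds z - log_odds p"]
          DERIV_rel_entropy[OF p] p r s01 by (metis less_le_trans less_trans not_le order_le_less_trans)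
      have "log_odds z - log_odds p \<le> \<Lambda>" using log_odds_mono[of z \<rho>] z s \<rho> p r by (simp add: \<Lambda>_def)
      then have "(s - r) * (log_odds z - log_odds p) \<le> (s - r) * \<Lambda>" using s by (intro mult_left_mono) auto
      then show ?thesis using z by (simp add: s_def)
    qed
    have "measure_pmf.prob (edge_pmf n s) ?G * exp (- L) \<le> measure_pmf.prob (edge_pmf n p) ?G"
    proof (rule bernoulli_product_change_of_measure[OF _ p s01])
      fix x assume x: "x \<in> ?G"
      let ?S = "nsets {1..n} 2"
      let ?X = "\<Sum>f\<in>?S. of_bool (x f) - s"
      \<comment> \<open>The centred edge count is half of the test with both vertex sets full, as
        each edge is seen in both orientations.\<close>
      have "pair_sum (\<lambda>f. of_bool (x f) - s) {1..n} {1..n} = 2 * ?X"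
        by (simp add: pair_sum_orientations[of "{1..n}"] orientations_full sum_distrib_left cong: sum.cong)
      then have X: "?X \<le> 4 * real n * ?q"
        using pair_sum_le_soft_cut[OF n, of "{1..n}" "{1..n}" "\<lambda>f. of_bool (x f) - s"] x by auto
      \<comment> \<open>Per edge the log likelihood ratio is affine in the indicator: its mean under
        \<open>s\<close> is the entropy, and its slope is the difference of log odds.\<close>
      have "(\<Sum>f\<in>?S. if x f then ln s - ln p else ln (1 - s) - ln (1 - p))
          = (\<Sum>f\<in>?S. rel_entropy s p + (log_odds s - log_odds p) * (of_bool (x f) - s))"
        using p s01 by (intro sum.cong) (auto simp: rel_entropy_interior log_odds_def algebra_simps)
      also have "\<dots> = real n * (real n - 1) / 2 * rel_entropy s p + (log_odds s - log_odds p) * ?X"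
        by (simp only: sum.distrib sum_constant card_edges sum_distrib_left)
      also have "\<dots> \<le> real n ^ 2 / 2 * (rel_entropy r p + K * \<Lambda> / ?q) + \<Lambda> * (4 * real n * ?q)"
      proof (rule add_mono)
        have "real n * (real n - 1) / 2 \<le> (real n)\<^sup>2 / 2" by (simp add: power2_eq_square algebra_simps)
        moreover have "0 \<le> rel_entropy s p" using rel_entropy_pos[OF p, of s] s s01 r by simp
        ultimately show "real n * (real n - 1) / 2 * rel_entropy s p
            \<le> real n ^ 2 / 2 * (rel_entropy r p + K * \<Lambda> / ?q)"
          using Is by (intro mult_mono) auto
        have "(log_odds s - log_odds p) * ?X \<le> (log_odds s - log_odds p) * (4 * real n * ?q)"
          using X slope by (intro mult_left_mono) auto
        also have "\<dots> \<le> \<Lambda> * (4 * real n * ?q)" using slope by (intro mult_right_mono) auto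
        finally show "(log_odds s - log_odds p) * ?X \<le> \<Lambda> * (4 * real n * ?q)" .
      qed
      also have "\<dots> = L"
      proof -
        have "real n ^ 2 / 2 * (K * \<Lambda> / ?q) = K * \<Lambda> / 2 * real n * (real n / ?q)"
          by (simp add: power2_eq_square)
        then have "real n ^ 2 / 2 * (K * \<Lambda> / ?q) = K * \<Lambda> / 2 * real n * ?q"
          by (simp only: real_div_sqrt of_nat_0_le_iff)
        then show ?thesis unfolding L_def by (simp add: algebra_simps)
      qed
      finally show "(\<Sum>f\<in>?S. if x f then ln s - ln p else ln (1 - s) - ln (1 - p)) \<le> L" .
    qed simp
    moreover have "1 / 2 * exp (- L) \<le> measure_pmf.prob (edge_pmf n s) ?G * exp (- L)"
      by (intro mult_right_mono prob_soft_cut_le n s01) auto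
    moreover have "measure_pmf.prob (edge_pmf n p) ?G \<le> measure_pmf.prob (edge_pmf n p) ?A"
      using GA by (intro measure_pmf.finite_measure_mono) auto
    moreover have "exp (- (real n ^ 2 / 2 * rel_entropy r p + K' * real n * ?q)) \<le> 1 / 2 * exp (- L)"
    proof -
      have "1 \<le> real n * ?q" using n1 q1 mult_mono[of 1 "real n" 1 ?q] by simp
      then have "ln 2 * 1 \<le> ln 2 * (real n * ?q)" by (intro mult_left_mono) auto
      then have "- (real n ^ 2 / 2 * rel_entropy r p + K' * real n * ?q) \<le> - ln 2 + - L"
        unfolding K'_def L_def by (simp add: algebra_simps)
      then have "exp (- (real n ^ 2 / 2 * rel_entropy r p + K' * real n * ?q)) \<le> exp (- ln 2 + - L)"
        by simp
      also have "\<dots> = 1 / 2 * exp (- L)" by (simp add: exp_diff exp_minus field_simps)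
      finally show ?thesis .
    qed
    ultimately show "exp (- (real n ^ 2 / 2 * rel_entropy r p + K' * real n * ?q)) \<le> measure_pmf.prob (edge_pmf n p) ?A"
      by linarith
  qed
qed

text \<open>The threshold is lowered by \<open>C * n ^ card V / sqrt n\<close> at a cost of the same
  order as the other errors. With \<open>C = 0\<close> this bounds the upper tail, with larger
  \<open>C\<close> the two-sided window.\<close>

lemma prob_hom_poly_tail_le:
  assumes V: "finite V" and E: "E \<subseteq> nsets V 2" "E \<noteq> {}" and p: "0 < p" "p < 1" and r: "p < r" "r < 1"
    and supp: "supported_at p (card E) r" and C: "C \<ge> 0"
  shows "\<exists>K. \<forall>n>0. measure_pmf.prob (edge_pmf n p)
      {x. real (card (inj_tuples V n)) * r ^ card E - C * (real n ^ card V / sqrt (real n))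
            \<le> hom_poly V E n (\<lambda>_ f. of_bool (x f))}
      \<le> exp (- (real n ^ 2 / 2 * rel_entropy r p) + K * real n * sqrt (real n))"
proof -
  obtain c where c: "c \<ge> 0" and supp: "\<And>y. 0 \<le> y \<Longrightarrow> y \<le> 1 \<Longrightarrow>
      rel_entropy r p + c * (y ^ card E - r ^ card E) \<le> rel_entropy y p"
    using supp unfolding supported_at_def by auto
  let ?d = "card E"
  have cV: "card V \<ge> 2"
  proof -
    obtain e where "e \<in> nsets V 2" using E by auto
    then show ?thesis using V by (auto simp: nsets_def dest: card_mono)
  qed
  let ?I = "rel_entropy r p"
  have I: "?I > 0" using rel_entropy_pos[OF p, of r] r by simp
  define v where "v = (real (card V))\<^sup>2"
  \<comment> \<open>The terms come from \<open>n * (n - 1) / 2\<close> edges against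
    \<open>n ^ 2 / 2\<close>, from injective tuples against all tuples, from the lowered threshold,
    and from the cut norm.\<close>
  define K where "K = ?I / 2 + c * (v / 2 + C / 2 + 2 * real ?d)"
  show ?thesis
  proof (intro exI[of _ K] allI impI)
    fix n :: nat assume n: "n > 0"
    let ?q = "sqrt (real n)"
    let ?J = "real (card (inj_tuples V n))"
    let ?N = "real n ^ (card V - 2)"
    define M where "M = ?J * r ^ ?d - C * (real n ^ card V / ?q)"
    let ?P = "measure_pmf.prob (edge_pmf n p) {x. M \<le> hom_poly V E n (\<lambda>_ f. of_bool (x f))}"
    have q1: "?q \<ge> 1" using n by simp
    have qq: "?q * ?q = real n" by simp
    have nq: "real n \<le> real n * ?q" using q1 n by simp
    have N: "?N > 0" using n by simp
    have pow: "real n ^ card V = ?N * real n ^ 2"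
      using cV by (simp only: power_add[symmetric] le_add_diff_inverse2)
    have r1: "0 \<le> r ^ ?d" "r ^ ?d \<le> 1" using p r by (auto intro: power_le_one)
    have "real n * ?J \<ge> real n * (real n ^ card V) - v * real n ^ card V"
      using card_inj_tuples_ge[OF V, of n] by (simp add: v_def)
    also have "real n * (real n ^ card V) - v * real n ^ card V = real n * (?N * (real n ^ 2 - v * real n))"
      unfolding pow by (simp add: power2_eq_square algebra_simps)
    finally have J: "?J \<ge> ?N * (real n ^ 2 - v * real n)"
      using n by (simp only: mult_le_cancel_left_pos of_nat_0_less_iff)
    have MN: "M / (2 * ?N) \<ge> real n ^ 2 / 2 * r ^ ?d - (v / 2 + C / 2) * (real n * ?q)"
    proof -
      have "?N * ((real n ^ 2 - v * real n) * r ^ ?d) \<le> ?J * r ^ ?d"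
        using mult_right_mono[OF J r1(1)] by (simp add: mult_ac)
      moreover have "real n ^ card V / ?q = ?N * (real n * ?q)"
        unfolding pow power2_eq_square
        by (simp only: times_divide_eq_right[symmetric] real_div_sqrt of_nat_0_le_iff)
      ultimately have "?N * ((real n ^ 2 - v * real n) * r ^ ?d - C * (real n * ?q)) \<le> M"
        unfolding M_def by (simp add: algebra_simps)
      then have "(real n ^ 2 - v * real n) * r ^ ?d - C * (real n * ?q) \<le> M / ?N"
        using N by (simp add: pos_le_divide_eq mult.commute)
      moreover have "v * real n * r ^ ?d \<le> v * (real n * ?q)"
      proof -
        have "v * (real n * r ^ ?d) \<le> v * (real n * ?q)"
          using order_trans[OF r1(2) q1] by (intro mult_left_mono) (auto simp: v_def)
        then show ?thesis by (simp add: mult.assoc)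
      qed
      moreover have "M / (2 * ?N) = M / ?N / 2" by simp
      ultimately show ?thesis by (simp add: algebra_simps)
    qed
    show "?P \<le> exp (- (real n ^ 2 / 2 * ?I) + K * real n * ?q)"
    proof (cases "?P > 0")
      case True
      have "ln ?P \<le> - (real n * (real n - 1) / 2 * (?I - c * r ^ ?d)
         + c * (M / (2 * ?N) - 2 * real ?d * real n * ?q))"
        using ln_prob_hom_poly_tail_le[OF V E p n c supp True] .
      also have "\<dots> \<le> - (real n ^ 2 / 2 * ?I) + K * real n * ?q"
      proof -
        have "c * (real n ^ 2 / 2 * r ^ ?d - (v / 2 + C / 2) * (real n * ?q) - 2 * real ?d * real n * ?q)
            \<le> c * (M / (2 * ?N) - 2 * real ?d * real n * ?q)"
          using MN c by (intro mult_left_mono) auto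
        moreover have "c * (real n ^ 2 / 2 * r ^ ?d - (v / 2 + C / 2) * (real n * ?q) - 2 * real ?d * real n * ?q)
            = real n ^ 2 / 2 * (c * r ^ ?d) - c * ((v / 2 + C / 2) * (real n * ?q)) - c * (2 * real ?d * (real n * ?q))"
          by (simp only: right_diff_distrib mult_ac)
        moreover have "real n * (real n - 1) / 2 * (?I - c * r ^ ?d)
            = real n ^ 2 / 2 * ?I - real n / 2 * ?I - real n ^ 2 / 2 * (c * r ^ ?d) + real n / 2 * (c * r ^ ?d)"
          by (simp add: power2_eq_square field_simps)
        moreover have "real n / 2 * ?I \<le> (real n * ?q) / 2 * ?I"
          using nq I by (intro mult_right_mono divide_right_mono) auto
        moreover have "real n / 2 * (c * r ^ ?d) \<ge> 0" using c r1 by simp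
        moreover have "K * real n * ?q = (real n * ?q) / 2 * ?I + c * ((v / 2 + C / 2) * (real n * ?q))
            + c * (2 * real ?d * (real n * ?q))"
          unfolding K_def by (simp add: algebra_simps)
        ultimately show ?thesis by linarith
      qed
      finally have le: "ln ?P \<le> - (real n ^ 2 / 2 * ?I) + K * real n * ?q" .
      have "?P = exp (ln ?P)" using True by (simp only: exp_ln)
      also have "\<dots> \<le> exp (- (real n ^ 2 / 2 * ?I) + K * real n * ?q)" using le by (simp only: exp_le_cancel_iff)
      finally show ?thesis .
    next
      case False
      then show ?thesis by (smt (verit) exp_gt_zero measure_nonneg)
    qed
  qed
qed

section \<open>From two-sided exponential bounds to the decay rate\<close>

lemma decays_at_rateI:
  assumes c: "c > 0"
    and lower: "\<forall>\<^sub>F n in sequentially. exp (- (real n ^ 2 / 2 * c + K * real n * sqrt (real n))) \<le> P n"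
    and upper: "\<forall>\<^sub>F n in sequentially. P n \<le> exp (- (real n ^ 2 / 2 * c) + K' * real n * sqrt (real n))"
  shows "decays_at_rate P c"
  unfolding decays_at_rate_def
proof (intro exI conjI)
  \<comment> \<open>Solved from the required identity, which thus holds exactly wherever
    \<open>P n > 0\<close> and \<open>n > 0\<close>. The two bounds serve to estimate its size: an
    error of order \<open>n * sqrt n\<close> divided by \<open>n ^ 2\<close>.\<close>
  define \<epsilon> where "\<epsilon> = (\<lambda>n. - (2 * ln (P n)) / (real n ^ 2 * c) - 1)"
  define L where "L = max K K'"
  have ev: "\<forall>\<^sub>F n in sequentially. n > 0 \<and> exp (- (real n ^ 2 / 2 * c + K * real n * sqrt (real n))) \<le> P n
     \<and> P n \<le> exp (- (real n ^ 2 / 2 * c) + K' * real n * sqrt (real n))"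
    using eventually_gt_at_top[of 0] lower upper by eventually_elim auto
  show "\<epsilon> \<in> O(\<lambda>n. real n powr (- 1 / 2))"
  proof (rule bigoI[of _ "2 * L / c"], rule eventually_mono[OF ev])
    fix n assume n: "n > 0 \<and> exp (- (real n ^ 2 / 2 * c + K * real n * sqrt (real n))) \<le> P n
     \<and> P n \<le> exp (- (real n ^ 2 / 2 * c) + K' * real n * sqrt (real n))"
    let ?q = "sqrt (real n)"
    have q: "?q > 0" "?q * ?q = real n" using n by auto
    have Ppos: "P n > 0" using n by (smt (verit) exp_gt_zero)
    have "ln (P n) \<le> - (real n ^ 2 / 2 * c) + K' * real n * ?q"
      using n Ppos by (metis ln_exp ln_le_cancel_iff exp_gt_zero)
    moreover have "- (real n ^ 2 / 2 * c + K * real n * ?q) \<le> ln (P n)"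
      using n Ppos by (metis ln_exp ln_le_cancel_iff exp_gt_zero)
    moreover have "K' * (real n * ?q) \<le> L * (real n * ?q)" "K * (real n * ?q) \<le> L * (real n * ?q)"
      unfolding L_def by (intro mult_right_mono; simp)+
    ultimately have "\<bar>ln (P n) + real n ^ 2 / 2 * c\<bar> \<le> L * (real n * ?q)"
      by (simp add: abs_le_iff mult.assoc)
    then have le: "\<bar>ln (P n) + real n ^ 2 / 2 * c\<bar> * (2 / (real n ^ 2 * c)) \<le> L * (real n * ?q) * (2 / (real n ^ 2 * c))"
      using c by (intro mult_right_mono) auto
    have eq: "L * (real n * ?q) * (2 / (real n ^ 2 * c)) = 2 * L / c * (1 / ?q)"
      using n c q by (simp add: power2_eq_square field_simps)
    have "\<epsilon> n = - (ln (P n) + real n ^ 2 / 2 * c) * (2 / (real n ^ 2 * c))"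
      unfolding \<epsilon>_def using n c by (simp add: field_simps)
    also have "\<bar>\<dots>\<bar> = \<bar>ln (P n) + real n ^ 2 / 2 * c\<bar> * \<bar>2 / (real n ^ 2 * c)\<bar>"
      by (simp only: abs_mult abs_minus_cancel)
    also have "\<bar>2 / (real n ^ 2 * c)\<bar> = 2 / (real n ^ 2 * c)" using c by simp
    also note le
    also note eq
    also have "1 / ?q = real n powr (- 1 / 2)"
      using n powr_minus_divide[of "real n" "1 / 2"] by (simp add: powr_half_sqrt)
    finally show "norm (\<epsilon> n) \<le> 2 * L / c * norm (real n powr (- 1 / 2))"
      by simp
  qed
  show "\<forall>\<^sub>F n in sequentially. P n = exp (- (real n ^ 2 * c / 2) * (1 + \<epsilon> n))"
  proof (rule eventually_mono[OF ev])
    fix n assume n: "n > 0 \<and> exp (- (real n ^ 2 / 2 * c + K * real n * sqrt (real n))) \<le> P n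
     \<and> P n \<le> exp (- (real n ^ 2 / 2 * c) + K' * real n * sqrt (real n))"
    have Ppos: "P n > 0" using n by (smt (verit) exp_gt_zero)
    have "- (real n ^ 2 * c / 2) * (1 + \<epsilon> n) = ln (P n)"
      unfolding \<epsilon>_def using n c by simp
    then show "P n = exp (- (real n ^ 2 * c / 2) * (1 + \<epsilon> n))" using Ppos by simp
  qed
qed

section \<open>Copy counts as normalised homomorphism polynomials\<close>

lemma card_automorphisms_pos:
  assumes "finite V"
  shows "card (automorphisms V E) > 0"
proof -
  have "finite (automorphisms V E)"
    using finite_permutations[OF assms] by (rule finite_subset[rotated]) (auto simp: automorphisms_def)
  moreover have "id \<in> automorphisms V E" by (simp add: automorphisms_def permutes_id)
  ultimately show ?thesis by (auto simp: card_gt_0_iff)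
qed

lemma image_edge_in_nsets:
  assumes "t \<in> inj_tuples V n" "e \<in> nsets V 2"
  shows "t ` e \<in> nsets {1..n} 2"
proof -
  obtain a b where ab: "e = {a, b}" "a \<in> V" "b \<in> V" "a \<noteq> b" using assms(2) edgeE by metis
  then have "t a \<noteq> t b" "t a \<in> {1..n}" "t b \<in> {1..n}"
    using assms(1) by (auto simp: inj_tuples_def inj_on_def PiE_def Pi_def)
  then show ?thesis by (simp add: ab)
qed

text \<open>Injective tuples send pattern edges to genuine pairs in \<open>{1..n}\<close>, so values
  of \<open>x\<close> elsewhere never enter.\<close>

lemma num_copies_eq_hom_poly:
  assumes V: "finite V" and E: "E \<subseteq> nsets V 2"
  shows "real (card (automorphisms V E)) * num_copies V E n {e \<in> nsets {1..n} 2. x e}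
      = hom_poly V E n (\<lambda>_ f. of_bool (x f))"
proof -
  have "(\<Prod>e\<in>E. of_bool (t ` e \<in> {e \<in> nsets {1..n} 2. x e})) = (\<Prod>e\<in>E. of_bool (x (t ` e)) :: real)"
    if "t \<in> inj_tuples V n" for t
    using image_edge_in_nsets[OF that] E by (intro prod.cong) auto
  then show ?thesis
    unfolding num_copies_def hom_poly_def inj_tuples_def[symmetric]
    using card_automorphisms_pos[OF V, of E] by simp
qed

lemma copy_level_eq:
  assumes "finite V"
  shows "real (card (automorphisms V E)) * copy_level V E n r
      = real (card (inj_tuples V n)) * r ^ card E"
  using card_automorphisms_pos[OF assms, of E] by (simp add: copy_level_def card_inj_tuples[OF assms])

lemma prob_gnp:
  "measure_pmf.prob (gnp n p) {G. Q G} = measure_pmf.prob (edge_pmf n p) {x. Q {e \<in> nsets {1..n} 2. x e}}"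
  by (simp add: gnp_def vimage_def)

section \<open>Density one: the complete graph\<close>

lemma hom_poly_less_if_missing_edge:
  assumes V: "finite V" and E: "E \<subseteq> nsets V 2" "E \<noteq> {}" and n: "card V \<le> n"
    and f: "f0 \<in> nsets {1..n} 2" "\<not> x f0"
  shows "hom_poly V E n (\<lambda>_ f. of_bool (x f)) < real (card (inj_tuples V n))"
proof -
  have finE: "finite E"
    using V E finite_subset finite_imp_finite_nsets by blast
  obtain e0 where e0: "e0 \<in> E" using E by auto
  obtain a b where ab: "e0 = {a, b}" "a \<in> V" "b \<in> V" "a \<noteq> b" using E e0 edgeE by (metis subsetD)
  obtain i j where ij: "f0 = {i, j}" "i \<in> {1..n}" "j \<in> {1..n}" "i \<noteq> j" using f edgeE by metis
  \<comment> \<open>A tuple is built that sends the pattern edge \<open>e0\<close> onto the missing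
    edge \<open>f0\<close>; there is room for the other vertices because
    \<open>card V \<le> n\<close>. This tuple contributes zero.\<close>
  have "card (V - {a, b}) \<le> card ({1..n} - {i, j})"
    using V ab ij n by (simp add: card_Diff_subset)
  then obtain g where g: "g ` (V - {a, b}) \<subseteq> {1..n} - {i, j}" "inj_on g (V - {a, b})"
    using card_le_inj[of "V - {a, b}" "{1..n} - {i, j}"] V by auto
  define t where "t = restrict (g(a := i, b := j)) V"
  have "inj_on (g(a := i, b := j)) V"
  proof (rule inj_onI)
    fix u w assume uw: "u \<in> V" "w \<in> V" "(g(a := i, b := j)) u = (g(a := i, b := j)) w"
    have "g z \<noteq> i \<and> g z \<noteq> j" if "z \<in> V" "z \<noteq> a" "z \<noteq> b" for z using g(1) that by blast
    then show "u = w" using uw ij(4) g(2) unfolding inj_on_def fun_upd_def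
      by (metis (no_types, lifting) Diff_iff insert_iff singletonD)
  qed
  moreover have "(g(a := i, b := j)) u \<in> {1..n}" if "u \<in> V" for u
    using g(1) ij(2,3) that by (cases "u = a \<or> u = b") auto
  ultimately have t: "t \<in> inj_tuples V n"
    unfolding t_def inj_tuples_def by (auto simp: inj_on_restrict_eq simp del: fun_upd_apply)
  have "t ` e0 = f0" using ab ij by (auto simp: t_def)
  then have 0: "(\<Prod>e\<in>E. of_bool (x (t ` e)) :: real) = 0"
    using f(2) e0 finE by (intro prod_zero) auto
  have "hom_poly V E n (\<lambda>_ f. of_bool (x f)) < (\<Sum>t\<in>inj_tuples V n. 1)"
    unfolding hom_poly_def
  proof (rule sum_strict_mono_ex1)
    show "\<forall>t\<in>inj_tuples V n. (\<Prod>e\<in>E. of_bool (x (t ` e)) :: real) \<le> 1"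
      by (auto intro!: prod_le_1)
    show "\<exists>t\<in>inj_tuples V n. (\<Prod>e\<in>E. of_bool (x (t ` e)) :: real) < 1"
      using t 0 by (intro bexI[of _ t]) auto
  qed (use V in simp)
  then show ?thesis by simp
qed

lemma hom_poly_le_card: "hom_poly V E n (\<lambda>_ f. of_bool (x f)) \<le> real (card (inj_tuples V n))"
proof -
  have "hom_poly V E n (\<lambda>_ f. of_bool (x f)) \<le> (\<Sum>t\<in>inj_tuples V n. 1)"
    unfolding hom_poly_def by (intro sum_mono prod_le_1) auto
  then show ?thesis by simp
qed

lemma hom_poly_full_iff:
  assumes V: "finite V" and E: "E \<subseteq> nsets V 2" "E \<noteq> {}" and n: "card V \<le> n"
  shows "real (card (inj_tuples V n)) \<le> hom_poly V E n (\<lambda>_ f. of_bool (x f))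
    \<longleftrightarrow> (\<forall>f\<in>nsets {1..n} 2. x f)"
proof
  assume "real (card (inj_tuples V n)) \<le> hom_poly V E n (\<lambda>_ f. of_bool (x f))"
  then show "\<forall>f\<in>nsets {1..n} 2. x f"
    using hom_poly_less_if_missing_edge[OF V E n, where x = x] by (meson not_le)
next
  assume "\<forall>f\<in>nsets {1..n} 2. x f"
  then have "(\<Prod>e\<in>E. of_bool (x (t ` e)) :: real) = 1" if "t \<in> inj_tuples V n" for t
    using image_edge_in_nsets[OF that] E by (intro prod.neutral) auto
  then show "real (card (inj_tuples V n)) \<le> hom_poly V E n (\<lambda>_ f. of_bool (x f))"
    by (simp add: hom_poly_def)
qed

lemma prob_complete_graph:
  assumes "0 < p" "p < 1"
  shows "measure_pmf.prob (edge_pmf n p) {x. \<forall>f\<in>nsets {1..n} 2. x f} = p ^ (n choose 2)"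
proof -
  have "{x :: nat set \<Rightarrow> bool. \<forall>f\<in>nsets {1..n} 2. x f} = Pi (nsets {1..n} 2) (\<lambda>_. {True})" by auto
  then show ?thesis
    using assms by (simp only: measure_Pi_pmf_Pi finite_edges) (simp add: measure_pmf_single)
qed

text \<open>The exponent \<open>n choose 2\<close> falls short of \<open>n ^ 2 / 2\<close> by
  \<open>n / 2\<close>, well within the allowed order \<open>n * sqrt n\<close>; the deficit only
  raises the probability, so \<open>K = 0\<close> serves below.\<close>

lemma decays_complete_graph:
  assumes p: "0 < p" "p < 1" and P: "\<forall>\<^sub>F n in sequentially. P n = p ^ (n choose 2)"
  shows "decays_at_rate P (rel_entropy 1 p)"
proof (rule decays_at_rateI[where K = 0 and K' = "- ln p"])
  show "0 < rel_entropy 1 p" using p by (simp add: rel_entropy_1)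
  have pw: "p ^ (n choose 2) = exp (- (real n ^ 2 / 2 * rel_entropy 1 p) + (- ln p) * (real n / 2))" for n
  proof -
    have "p ^ (n choose 2) = exp (real (n choose 2) * ln p)"
      using p by (simp add: exp_of_nat_mult)
    then show ?thesis
      using p by (simp add: real_choose_two rel_entropy_1 power2_eq_square field_simps)
  qed
  show "\<forall>\<^sub>F n in sequentially. exp (- (real n ^ 2 / 2 * rel_entropy 1 p + 0 * real n * sqrt (real n))) \<le> P n"
    using P
  proof eventually_elim
    case (elim n)
    have "0 \<le> - ln p * (real n / 2)" using p by (intro mult_nonneg_nonneg) auto
    then show ?case unfolding elim pw by simp
  qed
  show "\<forall>\<^sub>F n in sequentially. P n \<le> exp (- (real n ^ 2 / 2 * rel_entropy 1 p) + - ln p * real n * sqrt (real n))"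
    using P eventually_gt_at_top[of 0]
  proof eventually_elim
    case (elim n)
    have "real n / 2 \<le> real n * 1" by simp
    also have "\<dots> \<le> real n * sqrt (real n)" using elim by (intro mult_left_mono) auto
    finally have "- ln p * (real n / 2) \<le> - ln p * (real n * sqrt (real n))"
      using p by (intro mult_left_mono) auto
    then show ?case unfolding elim(1) pw by (simp add: mult.assoc)
  qed
qed

section \<open>Assembly for interior and full density\<close>

lemma decays_upper_tail_interior:
  assumes V: "finite V" and E: "E \<subseteq> nsets V 2" "E \<noteq> {}" and p: "0 < p" "p < 1" and r: "p < r" "r < 1"
    and supp: "supported_at p (card E) r"
  shows "decays_at_rate
      (\<lambda>n. measure_pmf.prob (gnp n p) {G. num_copies V E n G \<ge> copy_level V E n r}) (rel_entropy r p)"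
proof -
  let ?P = "\<lambda>n. measure_pmf.prob (edge_pmf n p)
      {x. real (card (inj_tuples V n)) * r ^ card E \<le> hom_poly V E n (\<lambda>_ f. of_bool (x f))}"
  have \<alpha>: "real (card (automorphisms V E)) > 0" using card_automorphisms_pos[OF V] by simp
  have "copy_level V E n r \<le> num_copies V E n {e \<in> nsets {1..n} 2. x e}
      \<longleftrightarrow> real (card (inj_tuples V n)) * r ^ card E \<le> hom_poly V E n (\<lambda>_ f. of_bool (x f))" for n x
    using num_copies_eq_hom_poly[OF V E(1), of n x] copy_level_eq[OF V, of E n r]
      mult_le_cancel_left_pos[OF \<alpha>, of "copy_level V E n r" "num_copies V E n {e \<in> nsets {1..n} 2. x e}"] \<alpha>
    by simp
  then have eq: "(\<lambda>n. measure_pmf.prob (gnp n p) {G. num_copies V E n G \<ge> copy_level V E n r}) = ?P"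
    by (simp add: prob_gnp)
  obtain K where up: "\<And>n. n > 0 \<Longrightarrow> measure_pmf.prob (edge_pmf n p)
      {x. real (card (inj_tuples V n)) * r ^ card E - 0 * (real n ^ card V / sqrt (real n))
            \<le> hom_poly V E n (\<lambda>_ f. of_bool (x f))}
      \<le> exp (- (real n ^ 2 / 2 * rel_entropy r p) + K * real n * sqrt (real n))"
    using prob_hom_poly_tail_le[OF V E p r supp, of 0] by auto
  obtain K' C where low: "\<forall>\<^sub>F n in sequentially.
    exp (- (real n ^ 2 / 2 * rel_entropy r p + K' * real n * sqrt (real n))) \<le>
    measure_pmf.prob (edge_pmf n p)
      {x. real (card (inj_tuples V n)) * r ^ card E \<le> hom_poly V E n (\<lambda>_ f. of_bool (x f)) \<and>
          hom_poly V E n (\<lambda>_ f. of_bool (x f))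
            \<le> real (card (inj_tuples V n)) * r ^ card E + C * (real n ^ card V / sqrt (real n))}"
    using prob_hom_poly_window_ge[OF V E p r] by blast
  show ?thesis
    unfolding eq
  proof (rule decays_at_rateI)
    show "0 < rel_entropy r p" using rel_entropy_pos[OF p, of r] r by simp
    show "\<forall>\<^sub>F n in sequentially. exp (- (real n ^ 2 / 2 * rel_entropy r p + K' * real n * sqrt (real n))) \<le> ?P n"
      by (rule eventually_mono[OF low], erule order_trans, rule measure_pmf.finite_measure_mono) auto
    show "\<forall>\<^sub>F n in sequentially. ?P n \<le> exp (- (real n ^ 2 / 2 * rel_entropy r p) + K * real n * sqrt (real n))"
      using eventually_gt_at_top[of 0] by (rule eventually_mono) (use up in simp)
  qed
qed

lemma decays_local_interior:
  assumes V: "finite V" and E: "E \<subseteq> nsets V 2" "E \<noteq> {}" and p: "0 < p" "p < 1" and r: "p < r" "r < 1"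
    and supp: "supported_at p (card E) r"
  shows "\<exists>C :: real. decays_at_rate
      (\<lambda>n. measure_pmf.prob (gnp n p)
        {G. \<bar>num_copies V E n G - copy_level V E n r\<bar> \<le> C * real n powr (real (card V) - 1 / 2)})
      (rel_entropy r p)"
proof -
  let ?h = "\<lambda>n x. hom_poly V E n (\<lambda>_ f. of_bool (x f))"
  let ?M = "\<lambda>n. real (card (inj_tuples V n)) * r ^ card E"
  let ?w = "\<lambda>n. real n ^ card V / sqrt (real n)"
  let ?\<alpha> = "real (card (automorphisms V E))"
  have \<alpha>: "?\<alpha> > 0" using card_automorphisms_pos[OF V] by simp
  obtain K' C0 where low: "\<forall>\<^sub>F n in sequentially.
    exp (- (real n ^ 2 / 2 * rel_entropy r p + K' * real n * sqrt (real n))) \<le>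
    measure_pmf.prob (edge_pmf n p) {x. ?M n \<le> ?h n x \<and> ?h n x \<le> ?M n + C0 * ?w n}"
    using prob_hom_poly_window_ge[OF V E p r] by blast
  \<comment> \<open>The window bound does not specify the sign of \<open>C0\<close>, whereas the
    tail bound asks for a nonnegative slack. The one-sided window above the level then lies inside
    the symmetric one.\<close>
  define C where "C = max 0 C0"
  obtain K where up: "\<And>n. n > 0 \<Longrightarrow> measure_pmf.prob (edge_pmf n p) {x. ?M n - C * ?w n \<le> ?h n x}
      \<le> exp (- (real n ^ 2 / 2 * rel_entropy r p) + K * real n * sqrt (real n))"
    using prob_hom_poly_tail_le[OF V E p r supp, of C] by (auto simp: C_def)
  let ?P = "\<lambda>n. measure_pmf.prob (gnp n p)
        {G. \<bar>num_copies V E n G - copy_level V E n r\<bar> \<le> C / ?\<alpha> * real n powr (real (card V) - 1 / 2)}"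
  have eq: "?P n = measure_pmf.prob (edge_pmf n p) {x. \<bar>?h n x - ?M n\<bar> \<le> C * ?w n}" if n: "n > 0" for n
  proof -
    have pw: "real n powr (real (card V) - 1 / 2) = ?w n"
      using n by (simp add: powr_diff powr_realpow powr_half_sqrt)
    have "\<bar>num_copies V E n {e \<in> nsets {1..n} 2. x e} - copy_level V E n r\<bar> \<le> C / ?\<alpha> * ?w n
      \<longleftrightarrow> \<bar>?h n x - ?M n\<bar> \<le> C * ?w n" (is "\<bar>?N - ?L\<bar> \<le> _ \<longleftrightarrow> _") for x
    proof -
      have "?h n x - ?M n = ?\<alpha> * (?N - ?L)"
        using num_copies_eq_hom_poly[OF V E(1), of n x] copy_level_eq[OF V, of E n r] \<alpha>
        by (simp add: right_diff_distrib)
      then have h: "\<bar>?h n x - ?M n\<bar> = ?\<alpha> * \<bar>?N - ?L\<bar>" using \<alpha> by (simp add: abs_mult)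
      have w: "C * ?w n = ?\<alpha> * (C / ?\<alpha> * ?w n)" using \<alpha> by simp
      show ?thesis unfolding h w mult_le_cancel_left_pos[OF \<alpha>] ..
    qed
    then show ?thesis unfolding prob_gnp pw by simp
  qed
  have "decays_at_rate ?P (rel_entropy r p)"
  proof (rule decays_at_rateI)
    show "0 < rel_entropy r p" using rel_entropy_pos[OF p, of r] r by simp
    show "\<forall>\<^sub>F n in sequentially. exp (- (real n ^ 2 / 2 * rel_entropy r p + K' * real n * sqrt (real n))) \<le> ?P n"
      using low eventually_gt_at_top[of 0]
    proof eventually_elim
      case (elim n)
      have "0 \<le> C * ?w n" by (simp add: C_def)
      moreover have "C0 * ?w n \<le> C * ?w n"
        by (rule mult_right_mono) (simp_all add: C_def)
      ultimately have "measure_pmf.prob (edge_pmf n p) {x. ?M n \<le> ?h n x \<and> ?h n x \<le> ?M n + C0 * ?w n} \<le> ?P n"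
        unfolding eq[OF elim(2)] by (intro measure_pmf.finite_measure_mono) auto
      then show ?case using elim(1) by linarith
    qed
    show "\<forall>\<^sub>F n in sequentially. ?P n \<le> exp (- (real n ^ 2 / 2 * rel_entropy r p) + K * real n * sqrt (real n))"
      using eventually_gt_at_top[of 0]
    proof eventually_elim
      case (elim n)
      have "?P n \<le> measure_pmf.prob (edge_pmf n p) {x. ?M n - C * ?w n \<le> ?h n x}"
        unfolding eq[OF elim] by (intro measure_pmf.finite_measure_mono) auto
      then show ?case using up[OF elim] by linarith
    qed
  qed
  then show ?thesis by blast
qed

text \<open>Tilting above \<open>r\<close> is impossible here. Instead, the count never exceeds the
  level at \<open>r = 1\<close>, so reaching it and deviating from it by at most 0 are both the
  event that the graph is complete.\<close>

lemma decays_at_full_density: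
  assumes V: "finite V" and E: "E \<subseteq> nsets V 2" "E \<noteq> {}" and p: "0 < p" "p < 1"
  shows "decays_at_rate
      (\<lambda>n. measure_pmf.prob (gnp n p) {G. num_copies V E n G \<ge> copy_level V E n 1}) (rel_entropy 1 p)"
    and "decays_at_rate
      (\<lambda>n. measure_pmf.prob (gnp n p)
        {G. \<bar>num_copies V E n G - copy_level V E n 1\<bar> \<le> 0 * real n powr (real (card V) - 1 / 2)})
      (rel_entropy 1 p)"
proof -
  have \<alpha>: "real (card (automorphisms V E)) > 0" using card_automorphisms_pos[OF V] by simp
  have h: "copy_level V E n 1 \<le> num_copies V E n {e \<in> nsets {1..n} 2. x e}
      \<longleftrightarrow> real (card (inj_tuples V n)) \<le> hom_poly V E n (\<lambda>_ f. of_bool (x f))"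
    and h': "num_copies V E n {e \<in> nsets {1..n} 2. x e} \<le> copy_level V E n 1" for n x
    using num_copies_eq_hom_poly[OF V E(1), of n x] copy_level_eq[OF V, of E n 1]
      mult_le_cancel_left_pos[OF \<alpha>, of "copy_level V E n 1" "num_copies V E n {e \<in> nsets {1..n} 2. x e}"]
      mult_le_cancel_left_pos[OF \<alpha>, of "num_copies V E n {e \<in> nsets {1..n} 2. x e}" "copy_level V E n 1"]
      hom_poly_le_card[of V E n x] \<alpha>
    by simp_all
  have ev: "measure_pmf.prob (gnp n p) {G. num_copies V E n G \<ge> copy_level V E n 1} = p ^ (n choose 2)"
    if "card V \<le> n" for n
    unfolding prob_gnp h hom_poly_full_iff[OF V E that] by (rule prob_complete_graph[OF p])
  then have ev: "\<forall>\<^sub>F n in sequentially.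
      measure_pmf.prob (gnp n p) {G. num_copies V E n G \<ge> copy_level V E n 1} = p ^ (n choose 2)"
    using eventually_ge_at_top[of "card V"] by (rule eventually_mono[rotated])
  show "decays_at_rate
      (\<lambda>n. measure_pmf.prob (gnp n p) {G. num_copies V E n G \<ge> copy_level V E n 1}) (rel_entropy 1 p)"
    by (rule decays_complete_graph[OF p]) (use ev in simp)
  have "measure_pmf.prob (gnp n p) {G. \<bar>num_copies V E n G - copy_level V E n 1\<bar> \<le> 0 * real n powr (real (card V) - 1 / 2)}
      = measure_pmf.prob (gnp n p) {G. num_copies V E n G \<ge> copy_level V E n 1}" for n
  proof -
    have "\<bar>num_copies V E n {e \<in> nsets {1..n} 2. x e} - copy_level V E n 1\<bar> \<le> 0 * real n powr (real (card V) - 1 / 2)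
       \<longleftrightarrow> copy_level V E n 1 \<le> num_copies V E n {e \<in> nsets {1..n} 2. x e}" for x
      using h'[of n x] by auto
    then show ?thesis unfolding prob_gnp by simp
  qed
  then show "decays_at_rate
      (\<lambda>n. measure_pmf.prob (gnp n p)
        {G. \<bar>num_copies V E n G - copy_level V E n 1\<bar> \<le> 0 * real n powr (real (card V) - 1 / 2)})
      (rel_entropy 1 p)"
    by (simp only:) (rule decays_complete_graph[OF p ev])
qed

theorem theorem14:
  fixes V :: "'a set" and E :: "'a set set" and p :: real
  assumes "finite V" and "E \<subseteq> nsets V 2" and "card E \<ge> 2"
    and "0 < p" and "p < 1"
  defines "upper_tail_at \<equiv> \<lambda>r. decays_at_rate
      (\<lambda>n. measure_pmf.prob (gnp n p) {G. num_copies V E n G \<ge> copy_level V E n r})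
      (rel_entropy r p)"
    and "local_at \<equiv> \<lambda>r. \<exists>C :: real. decays_at_rate
      (\<lambda>n. measure_pmf.prob (gnp n p)
        {G. \<bar>num_copies V E n G - copy_level V E n r\<bar> \<le> C * real n powr (real (card V) - 1 / 2)})
      (rel_entropy r p)"
  shows "(p > p_crit (card E) \<longrightarrow> (\<forall>r\<in>{p<..1}. upper_tail_at r)) \<and>
    (p > p_crit (card E) \<longrightarrow> (\<forall>r\<in>{p<..1}. local_at r)) \<and>
    (p \<le> p_crit (card E) \<longrightarrow>
      (\<exists>p' p''. p < p' \<and> p' \<le> p'' \<and> p'' < 1 \<and>
        (\<forall>r\<in>{p<..<p'} \<union> {p''<..1}. upper_tail_at r) \<and>
        (\<forall>r\<in>{p<..<p'} \<union> {p''<..1}. local_at r)))"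
proof -
  have E: "E \<noteq> {}" using assms(3) by auto
  \<comment> \<open>All three parts of the theorem reduce to the existence of a supporting line; at
    \<open>r = 1\<close> the exact probability takes its place.\<close>
  have both: "upper_tail_at r \<and> local_at r"
    if "p < r" "r \<le> 1" "r < 1 \<Longrightarrow> supported_at p (card E) r" for r
  proof (cases "r = 1")
    case True
    then show ?thesis
      unfolding upper_tail_at_def local_at_def
      using decays_at_full_density[OF assms(1,2) E assms(4,5)] by blast
  next
    case False
    then have "r < 1" using that by simp
    then show ?thesis
      unfolding upper_tail_at_def local_at_def
      using decays_upper_tail_interior[OF assms(1,2) E assms(4,5)]
        decays_local_interior[OF assms(1,2) E assms(4,5)] that by blast
  qed
  obtain p' where p': "p < p'" "p' < 1" "\<And>r. p < r \<Longrightarrow> r < p' \<Longrightarrow> supported_at p (card E) r"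
    using supported_at_near_p[OF assms(4,5,3)] by auto
  obtain p1 where p1: "p1 < 1" "\<And>r. p < r \<Longrightarrow> r < 1 \<Longrightarrow> p1 < r \<Longrightarrow> supported_at p (card E) r"
    using supported_at_near_1[OF assms(4,5,3)] by auto
  \<comment> \<open>The maximum enforces \<open>p' \<le> p''\<close>; the same pair then serves the
    upper tail and the local statement.\<close>
  define p'' where "p'' = max p' p1"
  have "upper_tail_at r \<and> local_at r" if "r \<in> {p<..<p'} \<union> {p''<..1}" for r
    using that p' p1 by (intro both) (auto simp: p''_def)
  moreover have "p' \<le> p''" "p'' < 1" using p' p1 by (auto simp: p''_def)
  moreover have "upper_tail_at r \<and> local_at r" if "p > p_crit (card E)" "r \<in> {p<..1}" for r
    using that by (intro both supported_at_supercritical assms) auto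
  ultimately show ?thesis using p'(1) by blast
qed

end
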